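(* Let $\alpha,\beta>-1$ with $(\alpha,\beta)\ne(-1/2,-1/2)$. Then the second order Riesz-Jacobi transform $R_2^{\alpha,\beta}$ is not bounded on $L^1(d\mu_{\alpha,\beta})$.
   Context: For $\alpha,\beta>-1$ let $d\mu_{\alpha,\beta}(\theta)=(\sin\frac\theta2)^{2\alpha+1}(\cos\frac\theta2)^{2\beta+1}d\theta$ on $(0,\pi)$ and $\tau_{\alpha,\beta}=\frac{\alpha+\beta+1}{2}$. Let $\mathcal P_n^{\alpha,\beta}(\theta)=c_n^{\alpha,\beta}P_n^{\alpha,\beta}(\cos\theta)$, $n\ge0$, where $P_n^{\alpha,\beta}$ are the classical Jacobi polynomials (Szegő's convention) and $c_n^{\alpha,\beta}>0$ are such that $\{\mathcal P_n^{\alpha,\beta}:n\ge0\}$ is an orthonormal basis of $L^2(d\mu_{\alpha,\beta})$. The Riesz-Jacobi transform of order $2$ is the bounded operator on $L^2(d\mu_{\alpha,\beta})$ given by the $L^2(d\mu_{\alpha,\beta})$-convergent series $$R_2^{\alpha,\beta}f=\sum_{n=1}^\infty|n+\tau_{\alpha,\beta}|^{-2}\langle f,\mathcal P_n^{\alpha,\beta}\rangle_{d\mu_{\alpha,\beta}}\,\partial_\theta^2\mathcal P_n^{\alpha,\beta}.$$ Since $\mu_{\alpha,\beta}$ is finite, $L^2(d\mu_{\alpha,\beta})\subset L^1(d\mu_{\alpha,\beta})$ densely. "Not bounded on $L^1(d\mu_{\alpha,\beta})$" means that $R_2^{\alpha,\beta}$ does not extend from $L^2(d\mu_{\alpha,\beta})$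 to a bounded operator on $L^1(d\mu_{\alpha,\beta})$, i.e. there is no constant $C$ with $\|R_2^{\alpha,\beta}f\|_{L^1(d\mu_{\alpha,\beta})}\le C\|f\|_{L^1(d\mu_{\alpha,\beta})}$ for all $f\in L^2(d\mu_{\alpha,\beta})$. *)

theory Defs
  imports "HOL-Analysis.Analysis"
begin

definition jacobi_measure :: "real \<Rightarrow> real \<Rightarrow> real measure" where
  "jacobi_measure \<alpha> \<beta> =
     density (restrict_space lborel {0<..<pi})
       (\<lambda>\<theta>. ennreal (sin (\<theta> / 2) powr (2 * \<alpha> + 1) * cos (\<theta> / 2) powr (2 * \<beta> + 1)))"

definition jacobi_tau :: "real \<Rightarrow> real \<Rightarrow> real" where
  "jacobi_tau \<alpha> \<beta> = (\<alpha> + \<beta> + 1) / 2"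

(* Formula (4.3.2) in Szego's "Orthogonal Polynomials"; the normalization is
   jacobi_P n \<alpha> \<beta> 1 = (n + \<alpha>) gchoose n. *)
definition jacobi_P :: "nat \<Rightarrow> real \<Rightarrow> real \<Rightarrow> real \<Rightarrow> real" where
  "jacobi_P n \<alpha> \<beta> x =
     (\<Sum>k\<le>n. ((real n + \<alpha>) gchoose (n - k)) * ((real n + \<beta>) gchoose k)
              * ((x - 1) / 2) ^ k * ((x + 1) / 2) ^ (n - k))"

definition jacobi_c :: "nat \<Rightarrow> real \<Rightarrow> real \<Rightarrow> real" where
  "jacobi_c n \<alpha> \<beta> =
     1 / sqrt (\<integral>\<theta>. (jacobi_P n \<alpha> \<beta> (cos \<theta>))\<^sup>2 \<partial>jacobi_measure \<alpha> \<beta>)"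

definition jacobi_trig :: "nat \<Rightarrow> real \<Rightarrow> real \<Rightarrow> real \<Rightarrow> real" where
  "jacobi_trig n \<alpha> \<beta> \<theta> = jacobi_c n \<alpha> \<beta> * jacobi_P n \<alpha> \<beta> (cos \<theta>)"

definition square_integrable :: "'a measure \<Rightarrow> ('a \<Rightarrow> real) \<Rightarrow> bool" where
  "square_integrable M f \<longleftrightarrow> f \<in> borel_measurable M \<and> integrable M (\<lambda>x. (f x)\<^sup>2)"

definition L2_inner :: "'a measure \<Rightarrow> ('a \<Rightarrow> real) \<Rightarrow> ('a \<Rightarrow> real) \<Rightarrow> real" where
  "L2_inner M f g = (\<integral>x. f x * g x \<partial>M)"

definition L2_norm :: "'a measure \<Rightarrow> ('a \<Rightarrow> real) \<Rightarrow> real" where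
  "L2_norm M f = sqrt (L2_inner M f f)"

definition L1_norm :: "'a measure \<Rightarrow> ('a \<Rightarrow> real) \<Rightarrow> real" where
  "L1_norm M f = (\<integral>x. \<bar>f x\<bar> \<partial>M)"

definition riesz_jacobi2_partial ::
    "real \<Rightarrow> real \<Rightarrow> (real \<Rightarrow> real) \<Rightarrow> nat \<Rightarrow> real \<Rightarrow> real" where
  "riesz_jacobi2_partial \<alpha> \<beta> f N \<theta> =
     (\<Sum>n=1..N. 1 / \<bar>real n + jacobi_tau \<alpha> \<beta>\<bar> ^ 2
        * L2_inner (jacobi_measure \<alpha> \<beta>) f (jacobi_trig n \<alpha> \<beta>)
        * (deriv ^^ 2) (jacobi_trig n \<alpha> \<beta>) \<theta>)"

(* The graph of the operator: g represents the class of the transform of f. An element of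
   L^2 is represented by any function in its class, so the limit of the series is only
   determined up to a null set; a relation avoids choosing a representative and assigns no
   value where the series does not converge. *)
definition riesz_jacobi2 ::
    "real \<Rightarrow> real \<Rightarrow> (real \<Rightarrow> real) \<Rightarrow> (real \<Rightarrow> real) \<Rightarrow> bool" where
  "riesz_jacobi2 \<alpha> \<beta> f g \<longleftrightarrow>
     square_integrable (jacobi_measure \<alpha> \<beta>) f \<and>
     square_integrable (jacobi_measure \<alpha> \<beta>) g \<and>
     (\<lambda>N. L2_norm (jacobi_measure \<alpha> \<beta>) (\<lambda>\<theta>. riesz_jacobi2_partial \<alpha> \<beta> f N \<theta> - g \<theta>))
       \<longlonglongrightarrow> 0"

(* For \<alpha>, \<beta> > -1 the measure is finite, so both f and g below are integrable and the
   two L1 norms are genuine. *)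
definition riesz_jacobi2_bounded_L1 :: "real \<Rightarrow> real \<Rightarrow> bool" where
  "riesz_jacobi2_bounded_L1 \<alpha> \<beta> \<longleftrightarrow>
     (\<exists>C::real. \<forall>f g. riesz_jacobi2 \<alpha> \<beta> f g \<longrightarrow>
        L1_norm (jacobi_measure \<alpha> \<beta>) g \<le> C * L1_norm (jacobi_measure \<alpha> \<beta>) f)"

end

theory Submission
  imports Defs
begin

text \<open>For a polynomial \<open>u\<close> in \<open>cos \<theta>\<close> the transform maps \<open>J u\<close> to \<open>u''\<close>, where \<open>J\<close> is the Jacobi operator,
  whose eigenfunctions are the Jacobi polynomials with eigenvalues \<open>(n + \<tau>)\<^sup>2\<close>. So it suffices to find \<open>u\<close> with
  \<open>J u\<close> bounded and \<open>u''\<close> unbounded in \<open>L\<^sup>1\<close>. With \<open>t = cos\<^sup>2(\<theta>/2)\<close> take \<open>du/dt = q\<close> for a truncation \<open>q\<close> of the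
  binomial series of \<open>(1 - t)\<^sup>-\<^sup>\<alpha>\<^sup>-\<^sup>1\<close>: up to \<open>\<tau>\<^sup>2 u\<close>, \<open>J u\<close> is minus \<open>(\<beta> + 1)(1 - t) q\<close> plus a
  nonnegative multiple of the first omitted power, an approximate point mass at \<open>\<theta> = 0\<close>. The first part is
  dominated by the integrable \<open>(1 - t)\<^sup>-\<^sup>\<alpha>\<close>, and the second has the same integral, because the range of \<open>J - \<tau>\<^sup>2\<close>
  has mean zero. On the other hand \<open>u''\<close> is \<open>(\<alpha> + 1/2) t q\<close> up to terms of the same kind, and the integral of
  \<open>t q\<close> grows like a harmonic sum. If \<open>\<alpha> = -1/2\<close>, reflect \<open>\<theta>\<close> to \<open>\<pi> - \<theta>\<close>, which swaps \<open>\<alpha>\<close> and \<open>\<beta>\<close>.\<close>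

section \<open>The Jacobi measure\<close>

text \<open>This variable runs from 1 at \<theta> = 0 down to 0 at \<theta> = pi, and reflecting the
  angle turns t into 1 - t.\<close>

definition cossq :: "real \<Rightarrow> real" where
  "cossq \<theta> = (cos (\<theta> / 2))\<^sup>2"

definition jacobi_weight :: "real \<Rightarrow> real \<Rightarrow> real \<Rightarrow> real" where
  "jacobi_weight \<alpha> \<beta> \<theta> = sin (\<theta> / 2) powr (2 * \<alpha> + 1) * cos (\<theta> / 2) powr (2 * \<beta> + 1)"

lemma jacobi_weight_measurable [measurable]: "jacobi_weight \<alpha> \<beta> \<in> borel_measurable borel"
  unfolding jacobi_weight_def by measurable

lemma cossq_measurable [measurable]: "cossq \<in> borel_measurable borel"
  unfolding cossq_def by measurable

lemma half_angle_pos: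
  assumes "0 < \<theta>" "\<theta> < pi"
  shows "0 < sin (\<theta> / 2)" "0 < cos (\<theta> / 2)"
  using assms by (auto intro!: sin_gt_zero cos_gt_zero_pi)

lemma jacobi_weight_nonneg: "0 \<le> jacobi_weight \<alpha> \<beta> \<theta>"
  by (simp add: jacobi_weight_def)

lemma jacobi_weight_pos: "0 < \<theta> \<Longrightarrow> \<theta> < pi \<Longrightarrow> 0 < jacobi_weight \<alpha> \<beta> \<theta>"
  using half_angle_pos[of \<theta>] by (simp add: jacobi_weight_def)

lemma jacobi_weight_reflect: "jacobi_weight \<alpha> \<beta> (pi - \<theta>) = jacobi_weight \<beta> \<alpha> \<theta>"
  by (simp add: jacobi_weight_def diff_divide_distrib cos_diff sin_diff mult.commute)

lemma cossq_reflect: "cossq (pi - \<theta>) = 1 - cossq \<theta>"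
  by (simp add: cossq_def diff_divide_distrib cos_diff sin_squared_eq)

section \<open>Reflection of the angle and integrability of the weight\<close>

lemma set_integrable_reflect:
  fixes f :: "real \<Rightarrow> real"
  shows "set_integrable lborel {0<..<pi} (\<lambda>\<theta>. f (pi - \<theta>)) \<longleftrightarrow> set_integrable lborel {0<..<pi} f"
proof -
  have "(\<lambda>\<theta>. indicator {0<..<pi} \<theta> *\<^sub>R f (pi - \<theta>)) =
        (\<lambda>\<theta>. (\<lambda>x. indicator {0<..<pi} x *\<^sub>R f x) (pi + (-1) * \<theta>))"
    by (auto simp: indicator_def)
  then show ?thesis
    unfolding set_integrable_def
    using lborel_integrable_real_affine_iff[of "-1" "\<lambda>x. indicator {0<..<pi} x *\<^sub>R f x" pi] by simp
qed

lemma set_integral_reflect: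
  fixes f :: "real \<Rightarrow> real"
  shows "(LINT \<theta>:{0<..<pi}|lborel. f (pi - \<theta>)) = (LINT \<theta>:{0<..<pi}|lborel. f \<theta>)"
proof -
  have "(\<lambda>\<theta>. indicator {0<..<pi} \<theta> *\<^sub>R f (pi - \<theta>)) =
        (\<lambda>\<theta>. (\<lambda>x. indicator {0<..<pi} x *\<^sub>R f x) (pi + (-1) * \<theta>))"
    by (auto simp: indicator_def)
  then show ?thesis
    unfolding set_lebesgue_integral_def
    using lborel_integral_real_affine[of "-1" "\<lambda>x. indicator {0<..<pi} x *\<^sub>R f x" pi] by simp
qed

lemma has_real_derivative_sin_half_powr:
  assumes "0 < x" "x < pi"
  shows "((\<lambda>\<theta>. sin (\<theta> / 2) powr r) has_real_derivative
    r / 2 * sin (x / 2) powr (r - 1) * cos (x / 2)) (at x)"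
proof -
  have "((\<lambda>\<theta>. sin (\<theta> / 2)) has_real_derivative cos (x / 2) / 2) (at x)"
    by (auto intro!: derivative_eq_intros)
  from DERIV_fun_powr[OF this half_angle_pos(1)[OF assms], of r]
  show ?thesis by (simp add: mult_ac)
qed

lemma has_real_derivative_cos_half_powr:
  assumes "0 < x" "x < pi"
  shows "((\<lambda>\<theta>. cos (\<theta> / 2) powr r) has_real_derivative
    - (r / 2) * cos (x / 2) powr (r - 1) * sin (x / 2)) (at x)"
proof -
  have "((\<lambda>\<theta>. cos (\<theta> / 2)) has_real_derivative - sin (x / 2) / 2) (at x)"
    by (auto intro!: derivative_eq_intros)
  from DERIV_fun_powr[OF this half_angle_pos(2)[OF assms], of r]
  show ?thesis by (simp add: mult_ac)
qed

text \<open>The integrand has an explicit antiderivative, continuous up to the endpoints because 2 *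
  a + 2 > 0. Nonnegativity then upgrades the gauge integral to absolute integrability.\<close>

lemma set_integrable_sin_powr_cos:
  assumes "a > -1"
  shows "set_integrable lborel {0<..<pi} (\<lambda>\<theta>. sin (\<theta> / 2) powr (2 * a + 1) * cos (\<theta> / 2))"
proof -
  let ?f = "\<lambda>\<theta>::real. sin (\<theta> / 2) powr (2 * a + 1) * cos (\<theta> / 2)"
  let ?F = "\<lambda>\<theta>::real. sin (\<theta> / 2) powr (2 * a + 2) / (a + 1)"
  have cont: "continuous_on {0..pi} ?F"
    using assms by (intro continuous_intros continuous_on_powr') (auto intro: sin_ge_zero)
  have "(?F has_vector_derivative ?f x) (at x)" if "x \<in> {0<..<pi}" for x
  proof -
    have "(?F has_real_derivative ?f x) (at x)"
      using assms that
      by (intro DERIV_cong[OF DERIV_cdivide[OF has_real_derivative_sin_half_powr]])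
        (auto simp: field_simps)
    then show ?thesis by (simp add: has_real_derivative_iff_has_vector_derivative)
  qed
  then have "(?f has_integral (?F pi - ?F 0)) {0..pi}"
    using cont by (intro fundamental_theorem_of_calculus_interior) auto
  moreover have "0 \<le> ?f x" if "x \<in> {0..pi}" for x
    using that by (intro mult_nonneg_nonneg cos_ge_zero) auto
  ultimately have "?f absolutely_integrable_on {0..pi}"
    by (intro nonnegative_absolutely_integrable_1) (auto simp: integrable_on_def)
  then have "?f absolutely_integrable_on {0<..<pi}"
    by (rule set_integrable_subset) auto
  \<comment> \<open>\<open>absolutely_integrable_on\<close> refers to the completed measure; for a
    Borel function this is the same as integrability over \<open>lborel\<close>.\<close>
  then show ?thesis
    by (simp add: set_integrable_def integrable_completion)
qed

text \<open>Each endpoint is singular in one factor only. Where cos^2 is at least 1/2, the weight is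
  at most a constant times the integrand of \<open>set_integrable_sin_powr_cos\<close>; elsewhere
  the reflected integrand serves.\<close>

lemma set_integrable_jacobi_weight:
  assumes "\<alpha> > -1" "\<beta> > -1"
  shows "set_integrable lborel {0<..<pi} (jacobi_weight \<alpha> \<beta>)"
proof -
  let ?f = "\<lambda>a \<theta>::real. sin (\<theta> / 2) powr (2 * a + 1) * cos (\<theta> / 2)"
  \<comment> \<open>For y^2 between 1/2 and 1, the power y^(2a) is at most 2^|a|, whatever the sign
    of a.\<close>
  define K where "K a = (2::real) powr \<bar>a\<bar>" for a :: real
  have Kb: "y powr (2 * a) \<le> K a" if "1 / 2 \<le> y\<^sup>2" "0 < y" "y \<le> 1" for a y :: real
  proof -
    have "y powr (2 * a) = (y\<^sup>2) powr a"
      using that by (simp add: powr_powr flip: powr_numeral)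
    also have "\<dots> \<le> (1/2) powr (- \<bar>a\<bar>)"
    proof (cases "a \<ge> 0")
      case True
      have "(y\<^sup>2) powr a \<le> 1" using that True by (intro powr_le1) (auto simp: power_le_one)
      also have "1 \<le> (1/2) powr (- \<bar>a\<bar>)" by (simp add: powr_minus powr_divide field_simps ge_one_powr_ge_zero)
      finally show ?thesis .
    next
      case False
      then show ?thesis using that by (simp, intro powr_mono2') auto
    qed
    also have "\<dots> = K a" by (simp add: K_def powr_divide powr_minus field_simps)
    finally show ?thesis .
  qed
  let ?g = "\<lambda>\<theta>. K \<beta> * ?f \<alpha> \<theta> + K \<alpha> * ?f \<beta> (pi - \<theta>)"
  have int: "set_integrable lborel {0<..<pi} ?g"
    using assms set_integrable_reflect[of "?f \<beta>"]
    by (intro set_integral_add set_integrable_mult_right) (simp_all add: set_integrable_sin_powr_cos)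
  have b: "norm (jacobi_weight \<alpha> \<beta> \<theta>) \<le> norm (?g \<theta>)" if "\<theta> \<in> {0<..<pi}" for \<theta>
  proof -
    let ?s = "sin (\<theta> / 2)" and ?c = "cos (\<theta> / 2)"
    have sc: "0 < ?s" "0 < ?c" using that half_angle_pos by auto
    have refl: "?f \<beta> (pi - \<theta>) = ?c powr (2 * \<beta> + 1) * ?s"
      by (simp add: diff_divide_distrib cos_diff sin_diff)
    have "jacobi_weight \<alpha> \<beta> \<theta> \<le> ?g \<theta>"
    proof (cases "1 / 2 \<le> ?c\<^sup>2")
      case True
      have "jacobi_weight \<alpha> \<beta> \<theta> = ?f \<alpha> \<theta> * ?c powr (2 * \<beta>)"
        using sc by (simp add: jacobi_weight_def powr_add)
      also have "\<dots> \<le> ?f \<alpha> \<theta> * K \<beta>"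
        using sc True by (intro mult_left_mono Kb) auto
      also have "\<dots> \<le> ?g \<theta>" unfolding refl using sc by (simp add: K_def mult.commute)
      finally show ?thesis .
    next
      case False
      have "jacobi_weight \<alpha> \<beta> \<theta> = ?f \<beta> (pi - \<theta>) * ?s powr (2 * \<alpha>)"
        unfolding refl using sc by (simp add: jacobi_weight_def powr_add)
      also have "\<dots> \<le> ?f \<beta> (pi - \<theta>) * K \<alpha>"
        unfolding refl using sc False by (intro mult_left_mono Kb) (auto simp: sin_squared_eq)
      also have "\<dots> \<le> ?g \<theta>" unfolding refl using sc by (simp add: K_def mult.commute)
      finally show ?thesis .
    qed
    then show ?thesis using jacobi_weight_nonneg[of \<alpha> \<beta> \<theta>] by simp
  qed
  show ?thesis
    by (rule set_integrable_bound[OF int]) (use b in \<open>auto simp: set_borel_measurable_def\<close>)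
qed

section \<open>Integration against the Jacobi measure\<close>

lemma integrable_jacobi_measure_iff:
  fixes h :: "real \<Rightarrow> real"
  assumes [measurable]: "h \<in> borel_measurable borel"
  shows "integrable (jacobi_measure \<alpha> \<beta>) h \<longleftrightarrow>
    set_integrable lborel {0<..<pi} (\<lambda>\<theta>. jacobi_weight \<alpha> \<beta> \<theta> * h \<theta>)"
proof -
  have [measurable]: "h \<in> borel_measurable (restrict_space lborel {0<..<pi})"
    "jacobi_weight \<alpha> \<beta> \<in> borel_measurable (restrict_space lborel {0<..<pi})"
    by (rule measurable_restrict_space1, simp)+
  show ?thesis
    unfolding jacobi_measure_def jacobi_weight_def[symmetric]
    by (subst integrable_real_density)
       (auto simp: jacobi_weight_nonneg integrable_restrict_space set_integrable_def)
qed

lemma integral_jacobi_measure: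
  fixes h :: "real \<Rightarrow> real"
  assumes [measurable]: "h \<in> borel_measurable borel"
  shows "(\<integral>\<theta>. h \<theta> \<partial>jacobi_measure \<alpha> \<beta>) =
    (LINT \<theta>:{0<..<pi}|lborel. jacobi_weight \<alpha> \<beta> \<theta> * h \<theta>)"
proof -
  have [measurable]: "h \<in> borel_measurable (restrict_space lborel {0<..<pi})"
    "jacobi_weight \<alpha> \<beta> \<in> borel_measurable (restrict_space lborel {0<..<pi})"
    by (rule measurable_restrict_space1, simp)+
  show ?thesis
    unfolding jacobi_measure_def jacobi_weight_def[symmetric]
    by (subst integral_real_density)
       (auto simp: jacobi_weight_nonneg integral_restrict_space set_lebesgue_integral_def)
qed

lemma space_jacobi_measure [simp]: "space (jacobi_measure \<alpha> \<beta>) = {0<..<pi}"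
  by (simp add: jacobi_measure_def space_restrict_space)

lemma borel_measurable_jacobi_measure:
  "h \<in> borel_measurable borel \<Longrightarrow> h \<in> borel_measurable (jacobi_measure \<alpha> \<beta>)"
  unfolding jacobi_measure_def
  by (subst measurable_cong_sets[OF sets_density refl], rule measurable_restrict_space1) simp

lemma integral_jacobi_measure_reflect:
  fixes h :: "real \<Rightarrow> real"
  assumes [measurable]: "h \<in> borel_measurable borel"
  shows "(\<integral>\<theta>. h (pi - \<theta>) \<partial>jacobi_measure \<alpha> \<beta>) = (\<integral>\<theta>. h \<theta> \<partial>jacobi_measure \<beta> \<alpha>)"
proof -
  have "(\<lambda>\<theta>. h (pi - \<theta>)) \<in> borel_measurable borel" by measurable
  from integral_jacobi_measure[OF this] integral_jacobi_measure[OF assms]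
  show ?thesis
    using set_integral_reflect[of "\<lambda>\<theta>. jacobi_weight \<beta> \<alpha> \<theta> * h \<theta>"]
    by (simp only: jacobi_weight_reflect)
qed

lemma cossq_bounds: "0 \<le> cossq \<theta>" "cossq \<theta> \<le> 1"
  by (simp_all add: cossq_def abs_square_le_1)

lemma poly_cossq_measurable [measurable]: "(\<lambda>\<theta>. poly p (cossq \<theta>)) \<in> borel_measurable borel"
  unfolding cossq_def by (intro borel_measurable_continuous_onI continuous_intros) auto

lemma integrable_jacobi_measure_poly:
  assumes "\<alpha> > -1" "\<beta> > -1"
  shows "integrable (jacobi_measure \<alpha> \<beta>) (\<lambda>\<theta>. poly p (cossq \<theta>))"
proof -
  have "compact (poly p ` {0..1})"
    by (intro compact_continuous_image continuous_intros compact_Icc)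
  then obtain B where B: "\<And>x. x \<in> {0..1} \<Longrightarrow> \<bar>poly p x\<bar> \<le> B"
    using compact_imp_bounded bounded_real by (metis imageI)
  have "set_integrable lborel {0<..<pi} (\<lambda>\<theta>. B * jacobi_weight \<alpha> \<beta> \<theta>)"
    using set_integrable_jacobi_weight[OF assms] by (rule set_integrable_mult_right[rotated])
  then have "set_integrable lborel {0<..<pi} (\<lambda>\<theta>. jacobi_weight \<alpha> \<beta> \<theta> * poly p (cossq \<theta>))"
  proof (rule set_integrable_bound)
    show "AE x in lborel. x \<in> {0<..<pi} \<longrightarrow>
        norm (jacobi_weight \<alpha> \<beta> x * poly p (cossq x)) \<le> norm (B * jacobi_weight \<alpha> \<beta> x)"
    proof (intro AE_I2 impI)
      fix x
      have "\<bar>poly p (cossq x)\<bar> \<le> \<bar>B\<bar>" using B[of "cossq x"] cossq_bounds[of x] by auto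
      then show "norm (jacobi_weight \<alpha> \<beta> x * poly p (cossq x)) \<le> norm (B * jacobi_weight \<alpha> \<beta> x)"
        using mult_left_mono[of "\<bar>poly p (cossq x)\<bar>" "\<bar>B\<bar>" "\<bar>jacobi_weight \<alpha> \<beta> x\<bar>"]
        by (simp add: abs_mult mult.commute)
    qed
  qed (simp add: set_borel_measurable_def)
  then show ?thesis by (simp add: integrable_jacobi_measure_iff)
qed

section \<open>The integral as a positive functional on polynomials\<close>

definition jint :: "real \<Rightarrow> real \<Rightarrow> real poly \<Rightarrow> real" where
  "jint \<alpha> \<beta> p = (\<integral>\<theta>. poly p (cossq \<theta>) \<partial>jacobi_measure \<alpha> \<beta>)"

text \<open>In the variable t the measure is w dt with w = (1 - t)^\<alpha> t^\<beta>, and this is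
  the weighted divergence (w t (1 - t) r)' / w.\<close>

definition jacobi_first :: "real \<Rightarrow> real \<Rightarrow> real poly \<Rightarrow> real poly" where
  "jacobi_first \<alpha> \<beta> r = [:0, 1, -1:] * pderiv r + [:\<beta> + 1, - (\<alpha> + \<beta> + 2):] * r"

text \<open>The integrand is, up to sign, the \<open>\<theta>\<close>-derivative of
  \<open>sin(\<theta>/2)\<^sup>2\<^sup>\<alpha>\<^sup>+\<^sup>2 cos(\<theta>/2)\<^sup>2\<^sup>\<beta>\<^sup>+\<^sup>2 r(cos\<^sup>2(\<theta>/2))\<close>, which vanishes at both ends.\<close>
lemma jint_jacobi_first:
  assumes "\<alpha> > -1" "\<beta> > -1"
  shows "jint \<alpha> \<beta> (jacobi_first \<alpha> \<beta> r) = 0"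
proof -
  let ?H = "\<lambda>\<theta>. sin (\<theta> / 2) powr (2 * \<alpha> + 2) * cos (\<theta> / 2) powr (2 * \<beta> + 2) * poly r ((cos (\<theta> / 2))\<^sup>2)"
  let ?h = "\<lambda>\<theta>. jacobi_weight \<alpha> \<beta> \<theta> * poly (jacobi_first \<alpha> \<beta> r) (cossq \<theta>)"
  have cont: "continuous_on {0..pi} ?H"
  \<comment> \<open>Both exponents are positive, which gives continuity at the two ends.\<close>
  proof (intro continuous_on_mult continuous_on_powr' ballI conjI impI)
    fix x :: real assume x: "x \<in> {0..pi}"
    show "0 \<le> sin (x / 2)" using x by (intro sin_ge_zero) auto
    show "0 \<le> cos (x / 2)" using x by (intro cos_ge_zero) auto
  qed (use assms in \<open>auto intro!: continuous_intros\<close>)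
  have "(?H has_vector_derivative - ?h x) (at x)" if x: "x \<in> {0<..<pi}" for x
  proof -
    let ?s = "sin (x / 2)" and ?c = "cos (x / 2)"
    have sc: "0 < ?s" "0 < ?c" using x half_angle_pos by auto
    have d1: "((\<lambda>\<theta>. sin (\<theta> / 2) powr (2 * \<alpha> + 2)) has_real_derivative
        (\<alpha> + 1) * ?s powr (2 * \<alpha> + 1) * ?c) (at x)"
      using has_real_derivative_sin_half_powr[of x "2 * \<alpha> + 2"] x
      by (simp add: add_divide_distrib add.commute)
    have d2: "((\<lambda>\<theta>. cos (\<theta> / 2) powr (2 * \<beta> + 2)) has_real_derivative
        - (\<beta> + 1) * ?c powr (2 * \<beta> + 1) * ?s) (at x)"
      using has_real_derivative_cos_half_powr[of x "2 * \<beta> + 2"] x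
      by (simp add: add_divide_distrib add.commute)
    have "((\<lambda>\<theta>. (cos (\<theta> / 2))\<^sup>2) has_real_derivative - (?s * ?c)) (at x)"
      by (auto intro!: derivative_eq_intros)
    from DERIV_chain2[OF poly_DERIV this]
    have d3: "((\<lambda>\<theta>. poly r ((cos (\<theta> / 2))\<^sup>2)) has_real_derivative
        poly (pderiv r) (?c\<^sup>2) * - (?s * ?c)) (at x)" .
    have s2: "?s powr (2 * \<alpha> + 2) = ?s powr (2 * \<alpha> + 1) * ?s"
      using sc by (simp add: powr_add power2_eq_square)
    have c2: "?c powr (2 * \<beta> + 2) = ?c powr (2 * \<beta> + 1) * ?c"
      using sc by (simp add: powr_add power2_eq_square)
    have ss: "?s * ?s = 1 - ?c\<^sup>2" by (simp add: sin_squared_eq flip: power2_eq_square)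
    define W where "W = ?s powr (2 * \<alpha> + 1) * ?c powr (2 * \<beta> + 1)"
    have "(?H has_real_derivative
        W * ((\<alpha> + 1) * ?c\<^sup>2 * poly r (?c\<^sup>2) - (\<beta> + 1) * (?s * ?s) * poly r (?c\<^sup>2)
          - (?s * ?s) * ?c\<^sup>2 * poly (pderiv r) (?c\<^sup>2))) (at x)"
      by (rule DERIV_cong[OF DERIV_mult[OF DERIV_mult[OF d1 d2] d3]], unfold s2 c2 W_def)
        (simp add: algebra_simps power2_eq_square)
    moreover have "jacobi_weight \<alpha> \<beta> x = W" by (simp add: W_def jacobi_weight_def)
    then have "W * ((\<alpha> + 1) * ?c\<^sup>2 * poly r (?c\<^sup>2) - (\<beta> + 1) * (?s * ?s) * poly r (?c\<^sup>2)
          - (?s * ?s) * ?c\<^sup>2 * poly (pderiv r) (?c\<^sup>2)) = - ?h x"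
      unfolding ss by (simp add: jacobi_first_def cossq_def algebra_simps power2_eq_square)
    ultimately show ?thesis by (simp add: has_real_derivative_iff_has_vector_derivative)
  qed
  then have "((\<lambda>\<theta>. - ?h \<theta>) has_integral (?H pi - ?H 0)) {0..pi}"
    using cont by (intro fundamental_theorem_of_calculus_interior) auto
  moreover have "?H pi - ?H 0 = 0" by simp
  ultimately have "((\<lambda>\<theta>. - ?h \<theta>) has_integral 0) {0<..<pi}"
    by (simp only: has_integral_Icc_iff_Ioo)
  from has_integral_neg[OF this] have "(?h has_integral 0) {0<..<pi}" by simp
  moreover have "set_integrable lborel {0<..<pi} ?h"
    using integrable_jacobi_measure_poly[OF assms] by (subst (asm) integrable_jacobi_measure_iff) auto
  then have "(LINT \<theta>:{0<..<pi}|lborel. ?h \<theta>) = integral {0<..<pi} ?h"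
    by (rule set_borel_integral_eq_integral)
  ultimately show ?thesis
    unfolding jint_def by (subst integral_jacobi_measure) auto
qed

context
  fixes \<alpha> \<beta> :: real
  assumes ab: "\<alpha> > -1" "\<beta> > -1"
begin

lemma jint_diff: "jint \<alpha> \<beta> (p - q) = jint \<alpha> \<beta> p - jint \<alpha> \<beta> q"
  by (simp add: jint_def integrable_jacobi_measure_poly ab)

lemma jint_smult: "jint \<alpha> \<beta> (smult c p) = c * jint \<alpha> \<beta> p"
  by (simp add: jint_def)

lemma jint_minus: "jint \<alpha> \<beta> (- p) = - jint \<alpha> \<beta> p"
  by (simp add: jint_def)

lemma jint_sum: "jint \<alpha> \<beta> (\<Sum>i\<in>A. f i) = (\<Sum>i\<in>A. jint \<alpha> \<beta> (f i))"
  by (simp add: jint_def poly_sum integrable_jacobi_measure_poly ab)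

text \<open>A vanishing integral would make \<open>p\<close> zero almost everywhere. But
  \<open>p\<close> has finitely many roots and \<open>cossq\<close> is injective on the interval, so
  the zero set is finite, hence null.\<close>

lemma jint_pos:
  assumes "\<And>t. 0 \<le> t \<Longrightarrow> t \<le> 1 \<Longrightarrow> 0 \<le> poly p t" "p \<noteq> 0"
  shows "0 < jint \<alpha> \<beta> p"
proof -
  have nn: "0 \<le> poly p (cossq \<theta>)" for \<theta> using assms(1) cossq_bounds by auto
  have "jint \<alpha> \<beta> p \<noteq> 0"
  proof
    assume "jint \<alpha> \<beta> p = 0"
    then have "AE \<theta> in jacobi_measure \<alpha> \<beta>. poly p (cossq \<theta>) = 0"
      unfolding jint_def
      by (subst (asm) integral_nonneg_eq_0_iff_AE) (auto simp: integrable_jacobi_measure_poly ab nn)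
    then have "AE \<theta> in lborel. \<theta> \<in> {0<..<pi} \<longrightarrow> 0 < ennreal (jacobi_weight \<alpha> \<beta> \<theta>) \<longrightarrow> poly p (cossq \<theta>) = 0"
      unfolding jacobi_measure_def jacobi_weight_def[symmetric]
      by (subst (asm) AE_density) (auto simp: AE_restrict_space_iff measurable_restrict_space1)
    then have ae: "AE \<theta> in lborel. \<theta> \<in> {0<..<pi} \<longrightarrow> poly p (cossq \<theta>) = 0"
      by eventually_elim (use jacobi_weight_pos in auto)
    let ?Z = "{\<theta> \<in> {0<..<pi}. poly p (cossq \<theta>) = 0}"
    have inj: "inj_on cossq {0<..<pi}"
    proof (rule inj_onI)
      fix x y :: real
      assume xy: "x \<in> {0<..<pi}" "y \<in> {0<..<pi}" "cossq x = cossq y"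
      then have "cos (x / 2) = cos (y / 2)"
        using half_angle_pos[of x] half_angle_pos[of y] by (simp add: cossq_def power2_eq_iff_nonneg)
      then show "x = y" using xy cos_inj_pi[of "x / 2" "y / 2"] by auto
    qed
    have "inj_on cossq ?Z" by (rule inj_on_subset[OF inj]) blast
    moreover have "cossq ` ?Z \<subseteq> {t. poly p t = 0}" by blast
    ultimately have "finite ?Z"
      using poly_roots_finite[OF assms(2)] by (rule inj_on_finite)
    then have "AE \<theta> in lborel. \<theta> \<notin> ?Z"
      by (rule AE_not_in[OF finite_imp_null_set_lborel])
    with ae have "AE \<theta> in lborel. \<theta> \<notin> {0<..<pi::real}" by eventually_elim auto
    then have "emeasure lborel {0<..<pi::real} = 0"
      by (subst (asm) AE_iff_measurable[of "{0<..<pi}"]) auto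
    then show False by simp
  qed
  moreover have "0 \<le> jint \<alpha> \<beta> p" unfolding jint_def by (simp add: nn)
  ultimately show ?thesis by simp
qed

end

section \<open>Jacobi polynomials\<close>

text \<open>Polynomials are taken in \<open>t = cos\<^sup>2(\<theta>/2) = (1 + x)/2\<close>; \<open>jacobi_op\<close> is the Jacobi differential
  operator in this variable. For \<open>\<alpha> = \<beta> = -1/2\<close> it is the second derivative in \<open>\<theta>\<close>.\<close>
definition jacobi_op :: "real \<Rightarrow> real \<Rightarrow> real poly \<Rightarrow> real poly" where
  "jacobi_op \<alpha> \<beta> p = jacobi_first \<alpha> \<beta> (pderiv p)"

lemma poly_jacobi_first:
  "poly (jacobi_first \<alpha> \<beta> r) t =
    t * (1 - t) * poly (pderiv r) t + (\<beta> + 1 - (\<alpha> + \<beta> + 2) * t) * poly r t"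
  by (simp add: jacobi_first_def algebra_simps)

lemma jacobi_first_add: "jacobi_first \<alpha> \<beta> (p + q) = jacobi_first \<alpha> \<beta> p + jacobi_first \<alpha> \<beta> q"
  by (rule poly_ext) (simp add: poly_jacobi_first pderiv_add algebra_simps)

lemma jacobi_first_smult: "jacobi_first \<alpha> \<beta> (smult c p) = smult c (jacobi_first \<alpha> \<beta> p)"
  by (simp add: jacobi_first_def pderiv_smult smult_add_right)

lemma jacobi_op_add: "jacobi_op \<alpha> \<beta> (p + q) = jacobi_op \<alpha> \<beta> p + jacobi_op \<alpha> \<beta> q"
  by (simp add: jacobi_op_def pderiv_add jacobi_first_add)

lemma jacobi_op_smult: "jacobi_op \<alpha> \<beta> (smult c p) = smult c (jacobi_op \<alpha> \<beta> p)"
  by (simp add: jacobi_op_def pderiv_smult jacobi_first_smult)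

lemma jacobi_op_0 [simp]: "jacobi_op \<alpha> \<beta> 0 = 0"
  by (simp add: jacobi_op_def jacobi_first_def)

lemma jacobi_op_sum: "jacobi_op \<alpha> \<beta> (\<Sum>i\<in>A. f i) = (\<Sum>i\<in>A. jacobi_op \<alpha> \<beta> (f i))"
  by (induction A rule: infinite_finite_induct) (simp_all add: jacobi_op_add)

text \<open>Lagrange's identity: the difference of the integrands is \<open>jacobi_first\<close> of
  the Wronskian of \<open>p\<close> and \<open>q\<close>, and so has mean zero.\<close>

lemma jint_jacobi_op_sym:
  assumes "\<alpha> > -1" "\<beta> > -1"
  shows "jint \<alpha> \<beta> (jacobi_op \<alpha> \<beta> p * q) = jint \<alpha> \<beta> (p * jacobi_op \<alpha> \<beta> q)"
proof -
  have "jacobi_op \<alpha> \<beta> p * q - p * jacobi_op \<alpha> \<beta> q = jacobi_first \<alpha> \<beta> (pderiv p * q - p * pderiv q)"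
    by (rule poly_ext) (simp add: jacobi_op_def poly_jacobi_first pderiv_diff pderiv_mult algebra_simps)
  then have "jint \<alpha> \<beta> (jacobi_op \<alpha> \<beta> p * q - p * jacobi_op \<alpha> \<beta> q) = 0"
    using jint_jacobi_first[OF assms] by simp
  then show ?thesis by (simp add: jint_diff assms)
qed

definition jacobi_coeff :: "nat \<Rightarrow> real \<Rightarrow> real \<Rightarrow> nat \<Rightarrow> real" where
  "jacobi_coeff n \<alpha> \<beta> k = ((real n + \<alpha>) gchoose (n - k)) * ((real n + \<beta>) gchoose k)"

text \<open>Szego's formula rewritten with (x - 1)/2 = t - 1 and (x + 1)/2 = t.\<close>

definition jacobi_poly :: "nat \<Rightarrow> real \<Rightarrow> real \<Rightarrow> real poly" where
  "jacobi_poly n \<alpha> \<beta> = (\<Sum>k\<le>n. smult (jacobi_coeff n \<alpha> \<beta> k) ([:-1, 1:] ^ k * [:0, 1:] ^ (n - k)))"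

lemma jacobi_P_cos: "jacobi_P n \<alpha> \<beta> (cos \<theta>) = poly (jacobi_poly n \<alpha> \<beta>) (cossq \<theta>)"
proof -
  have "cos \<theta> = 2 * cossq \<theta> - 1" using cos_double_cos[of "\<theta> / 2"] by (simp add: cossq_def)
  then have "(cos \<theta> - 1) / 2 = cossq \<theta> - 1" "(cos \<theta> + 1) / 2 = cossq \<theta>" by simp_all
  then show ?thesis
    by (simp only: jacobi_P_def) (simp add: jacobi_poly_def jacobi_coeff_def poly_sum mult_ac)
qed

text \<open>The extra factor restores the exponent i and so avoids i - 1, which truncates at i =
  0.\<close>

lemma poly_pderiv_power_mult:
  assumes "pderiv p = 1"
  shows "poly (pderiv (p ^ i)) x * poly p x = real i * poly p x ^ i"
  by (simp only: pderiv_power assms) (cases i; simp)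

text \<open>Here A = t - 1 and B = t, so t (1 - t) = - A B, and the zeroth order coefficient is -
  (\<alpha> + 1) B - (\<beta> + 1) A. Abstract A and B keep the powers unexpanded.\<close>

lemma jacobi_first_basis:
  assumes "pderiv A = 1" "pderiv B = 1" and AB: "\<And>x. poly A x = x - 1" "\<And>x. poly B x = x"
  shows "jacobi_first \<alpha> \<beta> (A ^ i * B ^ j) =
    - smult (real i + \<alpha> + 1) (A ^ i * B ^ (j + 1)) - smult (real j + \<beta> + 1) (A ^ (i + 1) * B ^ j)"
proof (rule poly_ext)
  fix x
  have d: "poly (pderiv (A ^ i)) x * (x - 1) = real i * (x - 1) ^ i"
    "poly (pderiv (B ^ j)) x * x = real j * x ^ j"
    using poly_pderiv_power_mult[OF assms(1), of i x] poly_pderiv_power_mult[OF assms(2), of j x]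
    by (simp_all add: AB)
  have "poly (jacobi_first \<alpha> \<beta> (A ^ i * B ^ j)) x =
      - ((poly (pderiv (A ^ i)) x * (x - 1)) * x ^ j * x)
      - (poly (pderiv (B ^ j)) x * x) * (x - 1) ^ i * (x - 1)
      - ((\<alpha> + 1) * x + (\<beta> + 1) * (x - 1)) * ((x - 1) ^ i * x ^ j)"
    by (simp add: poly_jacobi_first pderiv_mult AB) (simp add: algebra_simps)
  then show "poly (jacobi_first \<alpha> \<beta> (A ^ i * B ^ j)) x = poly (- smult (real i + \<alpha> + 1) (A ^ i * B ^ (j + 1))
      - smult (real j + \<beta> + 1) (A ^ (i + 1) * B ^ j)) x"
    unfolding d by (simp add: AB) (simp add: algebra_simps)
qed

text \<open>Substituting B = A + 1 in the terms where one exponent rises shows that, up to an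
  eigenvalue depending only on the total degree k + m, the operator lowers that degree by
  one.\<close>

lemma jacobi_op_basis:
  assumes "pderiv A = 1" "pderiv B = 1" and AB: "\<And>x. poly A x = x - 1" "\<And>x. poly B x = x"
  shows "jacobi_op \<alpha> \<beta> (A ^ k * B ^ m) + smult (real (k + m) * (real (k + m) + \<alpha> + \<beta> + 1)) (A ^ k * B ^ m) =
    smult (real m * (real m + \<beta>)) (A ^ k * B ^ (m - 1)) - smult (real k * (real k + \<alpha>)) (A ^ (k - 1) * B ^ m)"
proof -
  have "pderiv (A ^ k * B ^ m) = smult (real k) (A ^ (k - 1) * B ^ m) + smult (real m) (A ^ k * B ^ (m - 1))"
    by (simp add: pderiv_mult pderiv_power assms algebra_simps)
  then have "jacobi_op \<alpha> \<beta> (A ^ k * B ^ m) =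
      smult (real k) (jacobi_first \<alpha> \<beta> (A ^ (k - 1) * B ^ m)) +
      smult (real m) (jacobi_first \<alpha> \<beta> (A ^ k * B ^ (m - 1)))"
    by (simp add: jacobi_op_def jacobi_first_add jacobi_first_smult)
  then have "poly (jacobi_op \<alpha> \<beta> (A ^ k * B ^ m)) x = poly
     (smult (real k) (- smult (real (k - 1) + \<alpha> + 1) (A ^ (k - 1) * B ^ (m + 1)) -
           smult (real m + \<beta> + 1) (A ^ (k - 1 + 1) * B ^ m)) +
     smult (real m) (- smult (real k + \<alpha> + 1) (A ^ k * B ^ (m - 1 + 1)) -
           smult (real (m - 1) + \<beta> + 1) (A ^ (k + 1) * B ^ (m - 1)))) x" for x
    unfolding jacobi_first_basis[OF assms] by (rule arg_cong)
  note eq = this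
  show ?thesis
  proof (rule poly_ext)
    fix x :: real
    show "poly (jacobi_op \<alpha> \<beta> (A ^ k * B ^ m) + smult (real (k + m) * (real (k + m) + \<alpha> + \<beta> + 1)) (A ^ k * B ^ m)) x =
      poly (smult (real m * (real m + \<beta>)) (A ^ k * B ^ (m - 1)) - smult (real k * (real k + \<alpha>)) (A ^ (k - 1) * B ^ m)) x"
      unfolding poly_add eq
      \<comment> \<open>At a zero exponent the subtraction truncates, but the factor k or m vanishes
        there as well.\<close>
      by (cases k; cases m) (simp_all add: AB del: of_nat_Suc, simp_all add: algebra_simps)
  qed
qed

lemma pderiv_jacobi_linear: "pderiv [:-1, 1:: real:] = 1" "pderiv [:0, 1 :: real:] = 1"
  by (simp_all add: pderiv_pCons one_pCons)

text \<open>The absorption identity is applied to each binomial factor. The resulting ratio of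
  neighbouring coefficients is what cancels the lower degree terms in the eigenvalue
  equation.\<close>

lemma jacobi_coeff_Suc:
  assumes "k < n"
  shows "jacobi_coeff n \<alpha> \<beta> (Suc k) * (real (Suc k) * (real (Suc k) + \<alpha>)) =
    jacobi_coeff n \<alpha> \<beta> k * (real (n - k) * (real (n - k) + \<beta>))"
proof -
  define j where "j = n - Suc k"
  have n: "n - k = Suc j" "n - Suc k = j" "real n = real j + real k + 1"
    using assms by (auto simp: j_def of_nat_diff)
  have \<beta>: "real (Suc k) * ((real n + \<beta>) gchoose Suc k) = (real (Suc j) + \<beta>) * ((real n + \<beta>) gchoose k)"
    using gbinomial_mult_1[of "real n + \<beta>" k] n(3) by (simp add: algebra_simps)
  have \<alpha>: "real (Suc j) * ((real n + \<alpha>) gchoose Suc j) = (real (Suc k) + \<alpha>) * ((real n + \<alpha>) gchoose j)"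
    using gbinomial_mult_1[of "real n + \<alpha>" j] n(3) by (simp add: algebra_simps)
  have "jacobi_coeff n \<alpha> \<beta> (Suc k) * (real (Suc k) * (real (Suc k) + \<alpha>)) =
      ((real (Suc k) + \<alpha>) * ((real n + \<alpha>) gchoose j)) * (real (Suc k) * ((real n + \<beta>) gchoose Suc k))"
    by (simp only: jacobi_coeff_def n(2) mult_ac)
  also have "\<dots> = (real (Suc j) * ((real n + \<alpha>) gchoose Suc j)) * ((real (Suc j) + \<beta>) * ((real n + \<beta>) gchoose k))"
    by (simp only: \<alpha> \<beta>)
  also have "\<dots> = jacobi_coeff n \<alpha> \<beta> k * (real (n - k) * (real (n - k) + \<beta>))"
    by (simp only: jacobi_coeff_def n(1) mult_ac)
  finally show ?thesis .
qed

text \<open>All summands have total degree n, so \<open>jacobi_op_basis\<close> gives them one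
  common eigenvalue. What remains in degree n - 1 cancels by
  \<open>jacobi_coeff_Suc\<close>.\<close>

lemma jacobi_op_jacobi_poly:
  "jacobi_op \<alpha> \<beta> (jacobi_poly n \<alpha> \<beta>) = smult (- (real n * (real n + \<alpha> + \<beta> + 1))) (jacobi_poly n \<alpha> \<beta>)"
proof -
  define A B :: "real poly" where "A = [:-1, 1:]" and "B = [:0, 1:]"
  define a where "a = jacobi_coeff n \<alpha> \<beta>"
  define l where "l = real n * (real n + \<alpha> + \<beta> + 1)"
  have basis: "jacobi_op \<alpha> \<beta> (A ^ k * B ^ m) + smult (real (k + m) * (real (k + m) + \<alpha> + \<beta> + 1)) (A ^ k * B ^ m) =
    smult (real m * (real m + \<beta>)) (A ^ k * B ^ (m - 1)) - smult (real k * (real k + \<alpha>)) (A ^ (k - 1) * B ^ m)" for k m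
    by (rule jacobi_op_basis) (simp_all add: A_def B_def pderiv_jacobi_linear)
  have jp: "jacobi_poly n \<alpha> \<beta> = (\<Sum>k\<le>n. smult (a k) (A ^ k * B ^ (n - k)))"
    by (simp add: jacobi_poly_def A_def B_def a_def)
  have "jacobi_op \<alpha> \<beta> (jacobi_poly n \<alpha> \<beta>) + smult l (jacobi_poly n \<alpha> \<beta>) =
      (\<Sum>k\<le>n. smult (a k) (jacobi_op \<alpha> \<beta> (A ^ k * B ^ (n - k)) + smult l (A ^ k * B ^ (n - k))))"
    unfolding jp by (rule poly_ext)
      (simp add: jacobi_op_sum jacobi_op_smult poly_sum sum.distrib sum_distrib_left algebra_simps)
  also have "\<dots> = (\<Sum>k\<le>n. smult (a k) (smult (real (n - k) * (real (n - k) + \<beta>)) (A ^ k * B ^ (n - k - 1))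
      - smult (real k * (real k + \<alpha>)) (A ^ (k - 1) * B ^ (n - k))))"
  proof (intro sum.cong refl)
    fix k assume "k \<in> {..n}"
    then show "smult (a k) (jacobi_op \<alpha> \<beta> (A ^ k * B ^ (n - k)) + smult l (A ^ k * B ^ (n - k))) =
      smult (a k) (smult (real (n - k) * (real (n - k) + \<beta>)) (A ^ k * B ^ (n - k - 1))
      - smult (real k * (real k + \<alpha>)) (A ^ (k - 1) * B ^ (n - k)))"
      using basis[of k "n - k"] by (simp add: l_def)
  qed
  also have "\<dots> = (\<Sum>k\<le>n. smult (a k * (real (n - k) * (real (n - k) + \<beta>))) (A ^ k * B ^ (n - k - 1)))
      - (\<Sum>k\<le>n. smult (a k * (real k * (real k + \<alpha>))) (A ^ (k - 1) * B ^ (n - k)))"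
    by (simp only: smult_diff_right smult_smult sum_subtractf)
  \<comment> \<open>The summand k = n here and the summand k = 0 of the other sum carry a zero
    factor; shifting the latter by one puts both sums over k < n.\<close>
  also have "(\<Sum>k\<le>n. smult (a k * (real (n - k) * (real (n - k) + \<beta>))) (A ^ k * B ^ (n - k - 1))) =
      (\<Sum>k<n. smult (a k * (real (n - k) * (real (n - k) + \<beta>))) (A ^ k * B ^ (n - k - 1)))"
    by (intro sum.mono_neutral_right) auto
  also have "(\<Sum>k\<le>n. smult (a k * (real k * (real k + \<alpha>))) (A ^ (k - 1) * B ^ (n - k))) =
      (\<Sum>k<n. smult (a (Suc k) * (real (Suc k) * (real (Suc k) + \<alpha>))) (A ^ k * B ^ (n - k - 1)))"
    by (subst sum.atMost_shift) simp
  also have "\<dots> = (\<Sum>k<n. smult (a k * (real (n - k) * (real (n - k) + \<beta>))) (A ^ k * B ^ (n - k - 1)))"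
    unfolding a_def by (intro sum.cong refl, subst jacobi_coeff_Suc) auto
  finally have "jacobi_op \<alpha> \<beta> (jacobi_poly n \<alpha> \<beta>) + smult l (jacobi_poly n \<alpha> \<beta>) = 0" by simp
  then show ?thesis by (simp add: l_def eq_neg_iff_add_eq_0)
qed

section \<open>Leading coefficients, orthogonality and expansion\<close>

lemma coeff_jacobi_poly_eq_0:
  assumes "n < i"
  shows "coeff (jacobi_poly n \<alpha> \<beta>) i = 0"
proof -
  have "degree ([:-1, 1::real:] ^ k * [:0, 1:] ^ (n - k)) = n" if "k \<le> n" for k
    using that by (subst degree_mult_eq) (simp_all add: degree_power_eq)
  then show ?thesis
    using assms by (auto simp: jacobi_poly_def coeff_sum intro!: sum.neutral coeff_eq_0)
qed

text \<open>Every basis product is monic of degree n, so the coefficient is a Vandermonde sum, equal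
  to a Pochhammer symbol over n!. Its first factor n + \<alpha> + \<beta> + 1 is positive once n is
  at least 1.\<close>

lemma coeff_jacobi_poly_pos:
  assumes "\<alpha> > -1" "\<beta> > -1"
  shows "0 < coeff (jacobi_poly n \<alpha> \<beta>) n"
proof -
  have "coeff ([:-1, 1::real:] ^ k * [:0, 1:] ^ (n - k)) n = 1" if "k \<le> n" for k
  proof -
    have "degree ([:-1, 1::real:] ^ k * [:0, 1:] ^ (n - k)) = n"
      using that by (subst degree_mult_eq) (simp_all add: degree_power_eq)
    moreover have "lead_coeff ([:-1, 1::real:] ^ k * [:0, 1:] ^ (n - k)) = 1"
      by (simp add: lead_coeff_mult lead_coeff_power)
    ultimately show ?thesis by simp
  qed
  then have "coeff (jacobi_poly n \<alpha> \<beta>) n = (\<Sum>k\<le>n. jacobi_coeff n \<alpha> \<beta> k)"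
    by (simp add: jacobi_poly_def coeff_sum)
  also have "\<dots> = (2 * real n + \<alpha> + \<beta>) gchoose n"
    using gbinomial_Vandermonde[of "real n + \<beta>" "real n + \<alpha>" n]
    by (simp add: jacobi_coeff_def atMost_atLeast0 algebra_simps)
  also have "\<dots> = pochhammer (real n + \<alpha> + \<beta> + 1) n / fact n"
    by (simp add: gbinomial_pochhammer' algebra_simps)
  also have "0 < \<dots>"
  proof (cases "n = 0")
    case False
    then show ?thesis using assms by (intro divide_pos_pos pochhammer_pos) auto
  qed simp
  finally show ?thesis .
qed

text \<open>Symmetry of the operator and distinct eigenvalues: they differ by (m - n)(m + n +
  \<alpha> + \<beta> + 1), and the second factor is positive because m + n is at least 1.\<close>

lemma jint_jacobi_poly_orthogonal:
  assumes "\<alpha> > -1" "\<beta> > -1" "m \<noteq> n"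
  shows "jint \<alpha> \<beta> (jacobi_poly m \<alpha> \<beta> * jacobi_poly n \<alpha> \<beta>) = 0"
proof -
  let ?I = "jint \<alpha> \<beta> (jacobi_poly m \<alpha> \<beta> * jacobi_poly n \<alpha> \<beta>)"
  have "real m * (real m + \<alpha> + \<beta> + 1) * ?I = real n * (real n + \<alpha> + \<beta> + 1) * ?I"
    using jint_jacobi_op_sym[OF assms(1,2), of "jacobi_poly m \<alpha> \<beta>" "jacobi_poly n \<alpha> \<beta>"]
    by (simp add: jacobi_op_jacobi_poly jint_smult jint_minus assms)
  then have "(real m - real n) * (real m + real n + \<alpha> + \<beta> + 1) * ?I = 0"
    by (simp add: algebra_simps)
  moreover have "real m + real n + \<alpha> + \<beta> + 1 > 0" using assms by auto
  ultimately show ?thesis using assms(3) by auto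
qed

lemma jint_jacobi_poly_square_pos:
  assumes "\<alpha> > -1" "\<beta> > -1"
  shows "0 < jint \<alpha> \<beta> (jacobi_poly n \<alpha> \<beta> * jacobi_poly n \<alpha> \<beta>)"
  using coeff_jacobi_poly_pos[OF assms, of n] by (intro jint_pos assms) auto

text \<open>Elimination of the leading coefficient. Bounding the degree through coefficients lets N
  = 0 stand for the zero polynomial, where the induction starts.\<close>

lemma jacobi_poly_span:
  assumes "\<alpha> > -1" "\<beta> > -1" "\<And>i. N \<le> i \<Longrightarrow> coeff p i = 0"
  shows "\<exists>d. p = (\<Sum>n<N. smult (d n) (jacobi_poly n \<alpha> \<beta>))"
  using assms(3)
proof (induction N arbitrary: p)
  case 0
  then show ?case by (auto intro: poly_eqI)
next
  case (Suc N)
  define c where "c = coeff p N / coeff (jacobi_poly N \<alpha> \<beta>) N"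
  have "coeff (p - smult c (jacobi_poly N \<alpha> \<beta>)) i = 0" if "N \<le> i" for i
  proof (cases "i = N")
    case True
    then show ?thesis using coeff_jacobi_poly_pos[OF assms(1,2), of N] by (simp add: c_def)
  next
    case False
    then show ?thesis using that Suc.prems[of i] by (simp add: coeff_jacobi_poly_eq_0)
  qed
  from Suc.IH[OF this] obtain d where
    d: "p - smult c (jacobi_poly N \<alpha> \<beta>) = (\<Sum>n<N. smult (d n) (jacobi_poly n \<alpha> \<beta>))" by blast
  then have "p = (\<Sum>n<Suc N. smult ((d(N := c)) n) (jacobi_poly n \<alpha> \<beta>))"
    by (simp add: algebra_simps)
  then show ?case by blast
qed

lemma jacobi_poly_expansion:
  assumes "\<alpha> > -1" "\<beta> > -1" "degree p < N"
  shows "p = (\<Sum>n<N. smult (jint \<alpha> \<beta> (p * jacobi_poly n \<alpha> \<beta>) /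
    jint \<alpha> \<beta> (jacobi_poly n \<alpha> \<beta> * jacobi_poly n \<alpha> \<beta>)) (jacobi_poly n \<alpha> \<beta>))"
proof -
  let ?P = "\<lambda>n. jacobi_poly n \<alpha> \<beta>"
  obtain d where d: "p = (\<Sum>n<N. smult (d n) (?P n))"
    using jacobi_poly_span[OF assms(1,2), of N p] assms(3) coeff_eq_0[of p] by force
  have "jint \<alpha> \<beta> (p * ?P m) = d m * jint \<alpha> \<beta> (?P m * ?P m)" if "m < N" for m
  proof -
    have "jint \<alpha> \<beta> (p * ?P m) = (\<Sum>n<N. d n * jint \<alpha> \<beta> (?P n * ?P m))"
      by (subst d) (simp add: sum_distrib_right jint_sum jint_smult assms)
    also have "\<dots> = (\<Sum>n<N. if n = m then d m * jint \<alpha> \<beta> (?P m * ?P m) else 0)"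
      by (intro sum.cong) (auto simp: jint_jacobi_poly_orthogonal assms)
    finally show ?thesis using that by simp
  qed
  then have "d m = jint \<alpha> \<beta> (p * ?P m) / jint \<alpha> \<beta> (?P m * ?P m)" if "m < N" for m
    using that jint_jacobi_poly_square_pos[OF assms(1,2), of m] by simp
  then show ?thesis by (subst d) simp
qed

section \<open>The Riesz transform of trigonometric polynomials\<close>

lemma has_real_derivative_cossq: "(cossq has_real_derivative - (sin \<theta> / 2)) (at \<theta>)"
  unfolding cossq_def using sin_double[of "\<theta> / 2"]
  by (auto intro!: derivative_eq_intros)

lemma deriv_poly_cossq:
  "deriv (\<lambda>\<theta>. poly p (cossq \<theta>)) = (\<lambda>\<theta>. - (poly (pderiv p) (cossq \<theta>) * (sin \<theta> / 2)))"
  using DERIV_chain2[OF poly_DERIV has_real_derivative_cossq] by (intro ext DERIV_imp_deriv) simp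

text \<open>The chain rule with (dt/d\<theta>)^2 = t (1 - t) and second derivative 1/2 - t of t, the
  coefficients of the operator at parameters -1/2.\<close>

lemma deriv2_poly_cossq:
  "(deriv ^^ 2) (\<lambda>\<theta>. poly p (cossq \<theta>)) = (\<lambda>\<theta>. poly (jacobi_op (-1/2) (-1/2) p) (cossq \<theta>))"
proof
  fix \<theta> :: real
  have ss: "(sin \<theta> / 2) * (sin \<theta> / 2) = cossq \<theta> * (1 - cossq \<theta>)"
    using sin_double[of "\<theta> / 2"] by (simp add: cossq_def power2_eq_square sin_squared_eq[unfolded power2_eq_square, symmetric])
  have c: "cos \<theta> / 2 = cossq \<theta> - 1 / 2"
    using cos_double_cos[of "\<theta> / 2"] by (simp add: cossq_def)
  have "((\<lambda>\<theta>. sin \<theta> / 2) has_real_derivative cos \<theta> / 2) (at \<theta>)"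
    by (auto intro!: derivative_eq_intros)
  from DERIV_minus[OF DERIV_mult[OF DERIV_chain2[OF poly_DERIV has_real_derivative_cossq] this]]
  have "((\<lambda>\<theta>. - (poly (pderiv p) (cossq \<theta>) * (sin \<theta> / 2))) has_real_derivative
      poly (pderiv (pderiv p)) (cossq \<theta>) * ((sin \<theta> / 2) * (sin \<theta> / 2))
      - poly (pderiv p) (cossq \<theta>) * (cos \<theta> / 2)) (at \<theta>)"
    by (simp add: algebra_simps)
  then show "(deriv ^^ 2) (\<lambda>\<theta>. poly p (cossq \<theta>)) \<theta> = poly (jacobi_op (-1/2) (-1/2) p) (cossq \<theta>)"
    unfolding ss c
    by (simp add: numeral_2_eq_2 deriv_poly_cossq DERIV_imp_deriv jacobi_op_def poly_jacobi_first algebra_simps)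
qed

lemma jacobi_trig_eq: "jacobi_trig n \<alpha> \<beta> = (\<lambda>\<theta>. poly (smult (jacobi_c n \<alpha> \<beta>) (jacobi_poly n \<alpha> \<beta>)) (cossq \<theta>))"
  by (simp add: jacobi_trig_def jacobi_P_cos fun_eq_iff)

lemma jacobi_c_square:
  assumes "\<alpha> > -1" "\<beta> > -1"
  shows "jacobi_c n \<alpha> \<beta> * jacobi_c n \<alpha> \<beta> = 1 / jint \<alpha> \<beta> (jacobi_poly n \<alpha> \<beta> * jacobi_poly n \<alpha> \<beta>)"
  using jint_jacobi_poly_square_pos[OF assms, of n]
  by (simp add: jacobi_c_def jacobi_P_cos jint_def power2_eq_square)

lemma L2_inner_poly_cossq:
  "L2_inner (jacobi_measure \<alpha> \<beta>) (\<lambda>\<theta>. poly p (cossq \<theta>)) (\<lambda>\<theta>. poly q (cossq \<theta>)) = jint \<alpha> \<beta> (p * q)"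
  by (simp add: L2_inner_def jint_def)

lemma square_integrable_poly_cossq:
  assumes "\<alpha> > -1" "\<beta> > -1"
  shows "square_integrable (jacobi_measure \<alpha> \<beta>) (\<lambda>\<theta>. poly p (cossq \<theta>))"
  using integrable_jacobi_measure_poly[OF assms, of "p * p"] borel_measurable_jacobi_measure[OF poly_cossq_measurable]
  by (simp add: square_integrable_def power2_eq_square)

text \<open>The series omits the component of \<open>p\<close> along the constants, but the second derivative kills it
  anyway.\<close>
lemma riesz_jacobi2_poly:
  assumes "\<alpha> > -1" "\<beta> > -1"
  shows "riesz_jacobi2 \<alpha> \<beta> (\<lambda>\<theta>. poly (smult ((jacobi_tau \<alpha> \<beta>)\<^sup>2) p - jacobi_op \<alpha> \<beta> p) (cossq \<theta>))
    (\<lambda>\<theta>. poly (jacobi_op (-1/2) (-1/2) p) (cossq \<theta>))"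
proof -
  let ?\<tau> = "jacobi_tau \<alpha> \<beta>" and ?P = "\<lambda>n. jacobi_poly n \<alpha> \<beta>" and ?E = "jacobi_op (-1/2) (-1/2)"
  let ?f = "\<lambda>\<theta>. poly (smult (?\<tau>\<^sup>2) p - jacobi_op \<alpha> \<beta> p) (cossq \<theta>)"
  \<comment> \<open>Since n (n + 2 \<tau>) + \<tau>^2 = (n + \<tau>)^2, the coefficients of the
    input cancel the factors of the series.\<close>
  have inner: "jint \<alpha> \<beta> ((smult (?\<tau>\<^sup>2) p - jacobi_op \<alpha> \<beta> p) * ?P n) = (real n + ?\<tau>)\<^sup>2 * jint \<alpha> \<beta> (p * ?P n)" for n
  proof -
    have "jint \<alpha> \<beta> ((smult (?\<tau>\<^sup>2) p - jacobi_op \<alpha> \<beta> p) * ?P n) =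
        ?\<tau>\<^sup>2 * jint \<alpha> \<beta> (p * ?P n) - jint \<alpha> \<beta> (p * jacobi_op \<alpha> \<beta> (?P n))"
      using jint_jacobi_op_sym[OF assms, of p "?P n"] by (simp add: left_diff_distrib jint_diff jint_smult assms)
    also have "\<dots> = (real n + ?\<tau>)\<^sup>2 * jint \<alpha> \<beta> (p * ?P n)"
      by (simp add: jacobi_op_jacobi_poly jint_smult jint_minus assms)
         (simp add: jacobi_tau_def power2_eq_square field_simps)
    finally show ?thesis .
  qed
  have partial: "riesz_jacobi2_partial \<alpha> \<beta> ?f N \<theta> = poly (?E p) (cossq \<theta>)" if N: "degree p < Suc N" for N \<theta>
  proof -
    let ?d = "\<lambda>n. jint \<alpha> \<beta> (p * ?P n) / jint \<alpha> \<beta> (?P n * ?P n)"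
    have summand: "1 / \<bar>real n + ?\<tau>\<bar> ^ 2 * L2_inner (jacobi_measure \<alpha> \<beta>) ?f (jacobi_trig n \<alpha> \<beta>)
        * (deriv ^^ 2) (jacobi_trig n \<alpha> \<beta>) \<theta> = poly (smult (?d n) (?E (?P n))) (cossq \<theta>)"
      if "n \<in> {1..N}" for n
    proof -
      \<comment> \<open>The hypotheses give \<tau> > -1/2, so positivity starts at n = 1.\<close>
      have "real n + ?\<tau> > 0" using that assms by (simp add: jacobi_tau_def field_simps)
      then have "1 / \<bar>real n + ?\<tau>\<bar> ^ 2 * L2_inner (jacobi_measure \<alpha> \<beta>) ?f (jacobi_trig n \<alpha> \<beta>)
        * (deriv ^^ 2) (jacobi_trig n \<alpha> \<beta>) \<theta> =
        (jacobi_c n \<alpha> \<beta> * jacobi_c n \<alpha> \<beta>) * (jint \<alpha> \<beta> (p * ?P n) * poly (?E (?P n)) (cossq \<theta>))"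
        unfolding jacobi_trig_eq deriv2_poly_cossq L2_inner_poly_cossq
        by (simp add: jint_smult jacobi_op_smult inner assms)
      then show ?thesis by (simp add: jacobi_c_square assms)
    qed
    have E0: "jacobi_op a b (?P 0) = 0" for a b by (simp add: jacobi_op_def jacobi_first_def jacobi_poly_def pderiv_smult)
    have "riesz_jacobi2_partial \<alpha> \<beta> ?f N \<theta> = (\<Sum>n=1..N. poly (smult (?d n) (?E (?P n))) (cossq \<theta>))"
      unfolding riesz_jacobi2_partial_def by (intro sum.cong refl summand)
    also have "\<dots> = (\<Sum>n<Suc N. poly (smult (?d n) (?E (?P n))) (cossq \<theta>))"
      by (intro sum.mono_neutral_left) (auto simp: E0 not_less_eq_eq intro: Suc_leI)
    also have "\<dots> = poly (?E (\<Sum>n<Suc N. smult (?d n) (?P n))) (cossq \<theta>)"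
      by (simp only: poly_sum jacobi_op_sum jacobi_op_smult)
    also have "(\<Sum>n<Suc N. smult (?d n) (?P n)) = p"
      using jacobi_poly_expansion[OF assms N] by simp
    finally show ?thesis .
  qed
  \<comment> \<open>From the degree of \<open>p\<close> on, the partial sums equal their
    limit.\<close>
  have "\<forall>\<^sub>F N in sequentially. L2_norm (jacobi_measure \<alpha> \<beta>)
      (\<lambda>\<theta>. riesz_jacobi2_partial \<alpha> \<beta> ?f N \<theta> - poly (?E p) (cossq \<theta>)) = 0"
    using eventually_ge_at_top[of "degree p"]
    by eventually_elim (simp only: partial less_Suc_eq_le L2_norm_def L2_inner_def, simp)
  then have "(\<lambda>N. L2_norm (jacobi_measure \<alpha> \<beta>)
      (\<lambda>\<theta>. riesz_jacobi2_partial \<alpha> \<beta> ?f N \<theta> - poly (?E p) (cossq \<theta>))) \<longlonglongrightarrow> 0"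
    by (rule tendsto_eventually)
  then show ?thesis
    unfolding riesz_jacobi2_def by (intro conjI square_integrable_poly_cossq assms)
qed

section \<open>L1 norms of polynomials\<close>

definition jnorm :: "real \<Rightarrow> real \<Rightarrow> real poly \<Rightarrow> real" where
  "jnorm \<alpha> \<beta> p = L1_norm (jacobi_measure \<alpha> \<beta>) (\<lambda>\<theta>. poly p (cossq \<theta>))"

lemma jnorm_pcompose: "jnorm \<alpha> \<beta> (pcompose p [:1, -1:]) = jnorm \<beta> \<alpha> p"
  unfolding jnorm_def L1_norm_def
  by (subst integral_jacobi_measure_reflect[symmetric])
    (auto simp: cossq_reflect poly_pcompose intro: borel_measurable_abs)

lemma jacobi_op_pcompose: "jacobi_op \<alpha> \<beta> (pcompose p [:1, -1:]) = pcompose (jacobi_op \<beta> \<alpha> p) [:1, -1:]"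
  by (rule poly_ext)
    (simp add: jacobi_op_def poly_jacobi_first pderiv_pcompose pderiv_mult pderiv_minus pderiv_pCons poly_pcompose algebra_simps)

lemma jnorm_smult: "jnorm \<alpha> \<beta> (smult c p) = \<bar>c\<bar> * jnorm \<alpha> \<beta> p"
  by (simp add: jnorm_def L1_norm_def abs_mult)

lemma jnorm_minus: "jnorm \<alpha> \<beta> (- p) = jnorm \<alpha> \<beta> p"
  by (simp add: jnorm_def L1_norm_def)

lemma jnorm_nonneg: "0 \<le> jnorm \<alpha> \<beta> p"
  by (simp add: jnorm_def L1_norm_def)

context
  fixes \<alpha> \<beta> :: real
  assumes ab: "\<alpha> > -1" "\<beta> > -1"
begin

lemma jnorm_add_le: "jnorm \<alpha> \<beta> (p + q) \<le> jnorm \<alpha> \<beta> p + jnorm \<alpha> \<beta> q"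
proof -
  have "jnorm \<alpha> \<beta> (p + q) \<le> (\<integral>\<theta>. \<bar>poly p (cossq \<theta>)\<bar> + \<bar>poly q (cossq \<theta>)\<bar> \<partial>jacobi_measure \<alpha> \<beta>)"
    unfolding jnorm_def L1_norm_def
    using integrable_jacobi_measure_poly[OF ab] by (intro integral_mono) auto
  also have "\<dots> = jnorm \<alpha> \<beta> p + jnorm \<alpha> \<beta> q"
    unfolding jnorm_def L1_norm_def
    using integrable_jacobi_measure_poly[OF ab] by (intro Bochner_Integration.integral_add integrable_abs) auto
  finally show ?thesis .
qed

lemma jnorm_diff_le: "jnorm \<alpha> \<beta> (p - q) \<le> jnorm \<alpha> \<beta> p + jnorm \<alpha> \<beta> q"
  using jnorm_add_le[of p "- q"] by (simp add: jnorm_minus)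

lemma jint_mono:
  assumes "\<And>t. 0 \<le> t \<Longrightarrow> t \<le> 1 \<Longrightarrow> poly p t \<le> poly q t"
  shows "jint \<alpha> \<beta> p \<le> jint \<alpha> \<beta> q"
  unfolding jint_def
  using integrable_jacobi_measure_poly[OF ab] assms cossq_bounds by (intro integral_mono) auto

lemma jnorm_mono:
  assumes "\<And>t. 0 \<le> t \<Longrightarrow> t \<le> 1 \<Longrightarrow> \<bar>poly p t\<bar> \<le> \<bar>poly q t\<bar>"
  shows "jnorm \<alpha> \<beta> p \<le> jnorm \<alpha> \<beta> q"
  unfolding jnorm_def L1_norm_def
  using integrable_jacobi_measure_poly[OF ab] assms cossq_bounds by (intro integral_mono) auto

lemma jint_le_jnorm: "jint \<alpha> \<beta> p \<le> jnorm \<alpha> \<beta> p"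
  unfolding jint_def jnorm_def L1_norm_def
  using integrable_jacobi_measure_poly[OF ab] by (intro integral_mono) auto

end

lemma jnorm_eq_jint:
  assumes "\<And>t. 0 \<le> t \<Longrightarrow> t \<le> 1 \<Longrightarrow> 0 \<le> poly p t"
  shows "jnorm \<alpha> \<beta> p = jint \<alpha> \<beta> p"
  using assms cossq_bounds by (simp add: jint_def jnorm_def L1_norm_def)

section \<open>Truncated binomial series\<close>

text \<open>Coefficients of the binomial series of \<open>(1 - t)\<^sup>-\<^sup>\<alpha>\<^sup>-\<^sup>1\<close>.\<close>
definition binom_coeff :: "real \<Rightarrow> nat \<Rightarrow> real" where
  "binom_coeff \<alpha> j = pochhammer (\<alpha> + 1) j / fact j"

definition binom_trunc :: "real \<Rightarrow> nat \<Rightarrow> real poly" where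
  "binom_trunc \<alpha> N = (\<Sum>j\<le>N. monom (binom_coeff \<alpha> j) j)"

text \<open>The antiderivative that vanishes at t = 0; it serves as the test polynomial u.\<close>

definition binom_trunc_int :: "real \<Rightarrow> nat \<Rightarrow> real poly" where
  "binom_trunc_int \<alpha> N = (\<Sum>j\<le>N. monom (binom_coeff \<alpha> j / real (Suc j)) (Suc j))"

lemma binom_coeff_pos: "\<alpha> > -1 \<Longrightarrow> 0 < binom_coeff \<alpha> j"
  by (simp add: binom_coeff_def pochhammer_pos)

lemma binom_coeff_Suc: "real (Suc j) * binom_coeff \<alpha> (Suc j) = (real j + \<alpha> + 1) * binom_coeff \<alpha> j"
  by (simp add: binom_coeff_def pochhammer_Suc divide_simps)

lemma pderiv_binom_trunc_int: "pderiv (binom_trunc_int \<alpha> N) = binom_trunc \<alpha> N"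
proof (induction N)
  case 0
  then show ?case by (simp add: binom_trunc_int_def binom_trunc_def pderiv_monom)
next
  case (Suc N)
  then show ?case by (simp add: binom_trunc_int_def binom_trunc_def pderiv_add pderiv_monom del: of_nat_Suc)
qed

text \<open>The full series solves (1 - t) q' = (\<alpha> + 1) q. By the coefficient recurrence,
  truncation leaves a defect in degree N only.\<close>

lemma pderiv_binom_trunc:
  "(1 - t) * poly (pderiv (binom_trunc \<alpha> N)) t =
    (\<alpha> + 1) * poly (binom_trunc \<alpha> N) t - (real N + \<alpha> + 1) * binom_coeff \<alpha> N * t ^ N"
proof (induction N)
  case 0
  then show ?case by (simp add: binom_trunc_def pderiv_monom poly_monom)
next
  case (Suc N)
  have "(1 - t) * poly (pderiv (binom_trunc \<alpha> (Suc N))) t =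
      (1 - t) * poly (pderiv (binom_trunc \<alpha> N)) t + (1 - t) * (real (Suc N) * binom_coeff \<alpha> (Suc N)) * t ^ N"
    by (simp add: binom_trunc_def pderiv_add pderiv_monom poly_monom algebra_simps del: of_nat_Suc)
  also have "\<dots> = (\<alpha> + 1) * poly (binom_trunc \<alpha> N) t - real (Suc N) * binom_coeff \<alpha> (Suc N) * t ^ Suc N"
    unfolding Suc.IH using binom_coeff_Suc[of N \<alpha>] by (simp add: algebra_simps)
  also have "\<dots> = (\<alpha> + 1) * poly (binom_trunc \<alpha> (Suc N)) t
      - (real (Suc N) + \<alpha> + 1) * binom_coeff \<alpha> (Suc N) * t ^ Suc N"
    by (simp add: binom_trunc_def poly_monom algebra_simps)
  finally show ?case .
qed

lemma binom_trunc_nonneg: "\<alpha> > -1 \<Longrightarrow> 0 \<le> t \<Longrightarrow> 0 \<le> poly (binom_trunc \<alpha> N) t"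
  by (auto simp: binom_trunc_def poly_sum poly_monom intro!: sum_nonneg mult_nonneg_nonneg less_imp_le[OF binom_coeff_pos])

lemma binom_trunc_int_nonneg: "\<alpha> > -1 \<Longrightarrow> 0 \<le> t \<Longrightarrow> 0 \<le> poly (binom_trunc_int \<alpha> N) t"
  by (auto simp: binom_trunc_int_def poly_sum poly_monom intro!: sum_nonneg mult_nonneg_nonneg divide_nonneg_nonneg less_imp_le[OF binom_coeff_pos])

lemma binom_trunc_int_le:
  assumes "\<alpha> > -1" "0 \<le> t" "t \<le> 1"
  shows "poly (binom_trunc_int \<alpha> N) t \<le> poly (binom_trunc \<alpha> N) t"
  unfolding binom_trunc_int_def binom_trunc_def poly_sum poly_monom
proof (intro sum_mono mult_mono)
  fix j
  show "binom_coeff \<alpha> j / real (Suc j) \<le> binom_coeff \<alpha> j"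
    using binom_coeff_pos[OF assms(1), of j] by (simp add: divide_le_eq algebra_simps)
  show "t ^ Suc j \<le> t ^ j" using assms by (intro power_decreasing) auto
qed (use assms binom_coeff_pos[OF assms(1)] in \<open>auto intro: less_imp_le\<close>)

text \<open>The binomial series has nonnegative terms, so its partial sums stay below its
  sum.\<close>

lemma binom_trunc_le:
  assumes "\<alpha> > -1" "0 \<le> t" "t < 1"
  shows "poly (binom_trunc \<alpha> N) t \<le> (1 - t) powr (- (\<alpha> + 1))"
proof -
  have "(- (\<alpha> + 1) gchoose n) * (- t) ^ n = binom_coeff \<alpha> n * t ^ n" for n
  proof -
    have "(- 1 :: real) ^ n * (- t) ^ n = t ^ n" by (simp flip: power_mult_distrib)
    then show ?thesis by (simp add: gbinomial_pochhammer binom_coeff_def add.commute mult_ac)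
  qed
  then have s: "(\<lambda>n. binom_coeff \<alpha> n * t ^ n) sums (1 - t) powr (- (\<alpha> + 1))"
    using gen_binomial_real[of "- t" "- (\<alpha> + 1)"] assms by simp
  have "poly (binom_trunc \<alpha> N) t = (\<Sum>n\<in>{..N}. binom_coeff \<alpha> n * t ^ n)"
    by (simp add: binom_trunc_def poly_sum poly_monom)
  also have "\<dots> \<le> (\<Sum>n. binom_coeff \<alpha> n * t ^ n)"
    using assms binom_coeff_pos[OF assms(1)] s
    by (intro sum_le_suminf) (auto intro!: mult_nonneg_nonneg simp: sums_iff less_imp_le)
  also have "\<dots> = (1 - t) powr (- (\<alpha> + 1))" using s by (simp add: sums_iff)
  finally show ?thesis .
qed

section \<open>Bounds for the test polynomials, uniform in the truncation\<close>

context
  fixes \<alpha> \<beta> :: real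
  assumes ab: "\<alpha> > -1" "\<beta> > -1"
begin

text \<open>The integrand is dominated by (1 - t)^(-\<alpha>), which turns the weight with parameter
  \<alpha> into the integrable one with parameter 0.\<close>

lemma jint_binom_trunc_bounded: "\<exists>M. \<forall>N. jint \<alpha> \<beta> ([:1, -1:] * binom_trunc \<alpha> N) \<le> M"
proof (intro exI allI)
  fix N
  let ?g = "\<lambda>\<theta>. (1 - cossq \<theta>) powr (- \<alpha>)"
  have m [measurable]: "?g \<in> borel_measurable borel" by measurable
  have c: "0 < cossq \<theta>" "cossq \<theta> < 1" "1 - cossq \<theta> = (sin (\<theta> / 2))\<^sup>2" if "\<theta> \<in> {0<..<pi}" for \<theta>
    using that half_angle_pos[of \<theta>] sin_squared_eq[of "\<theta> / 2"] zero_less_power[of "sin (\<theta> / 2)" 2]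
    by (auto simp: cossq_def)
  have "jacobi_weight \<alpha> \<beta> \<theta> * ?g \<theta> = jacobi_weight 0 \<beta> \<theta>" if "\<theta> \<in> {0<..<pi}" for \<theta>
  proof -
    have "0 < sin (\<theta> / 2)" using that half_angle_pos by auto
    then have "?g \<theta> = sin (\<theta> / 2) powr (2 * - \<alpha>)"
      unfolding c(3)[OF that] by (simp add: powr_powr flip: powr_numeral)
    then show ?thesis using \<open>0 < sin (\<theta> / 2)\<close>
      by (simp add: jacobi_weight_def powr_add[symmetric])
  qed
  then have "set_integrable lborel {0<..<pi} (\<lambda>\<theta>. jacobi_weight \<alpha> \<beta> \<theta> * ?g \<theta>)"
    using set_integrable_jacobi_weight[of 0 \<beta>] ab by (subst set_integrable_cong[OF refl]) auto
  then have int: "integrable (jacobi_measure \<alpha> \<beta>) ?g"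
    by (subst integrable_jacobi_measure_iff) (rule m)
  show "jint \<alpha> \<beta> ([:1, -1:] * binom_trunc \<alpha> N) \<le> (\<integral>\<theta>. ?g \<theta> \<partial>jacobi_measure \<alpha> \<beta>)"
    unfolding jint_def
  proof (rule integral_mono[OF integrable_jacobi_measure_poly[OF ab] int])
    fix \<theta> assume "\<theta> \<in> space (jacobi_measure \<alpha> \<beta>)"
    then have t: "0 < cossq \<theta>" "cossq \<theta> < 1" using c by auto
    have "poly ([:1, -1:] * binom_trunc \<alpha> N) (cossq \<theta>) = (1 - cossq \<theta>) * poly (binom_trunc \<alpha> N) (cossq \<theta>)"
      by (simp add: algebra_simps)
    also have "\<dots> \<le> (1 - cossq \<theta>) * (1 - cossq \<theta>) powr (- (\<alpha> + 1))"
      using t binom_trunc_le[OF ab(1)] by (intro mult_left_mono) auto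
    also have "\<dots> = ?g \<theta>" using t by (simp add: powr_mult_base)
    finally show "poly ([:1, -1:] * binom_trunc \<alpha> N) (cossq \<theta>) \<le> ?g \<theta>" .
  qed
qed

text \<open>The truncated differential equation replaces t (1 - t) q' by (\<alpha> + 1) t q minus
  the top monomial, and the terms in q combine to a multiple of (1 - t) q.\<close>

lemma jacobi_op_binom_trunc_int:
  "jacobi_op \<alpha> b (binom_trunc_int \<alpha> N) =
    smult (b + 1) ([:1, -1:] * binom_trunc \<alpha> N) - monom ((real N + \<alpha> + 1) * binom_coeff \<alpha> N) (Suc N)"
proof (rule poly_ext)
  fix t
  have "poly (jacobi_op \<alpha> b (binom_trunc_int \<alpha> N)) t =
      t * ((1 - t) * poly (pderiv (binom_trunc \<alpha> N)) t) + (b + 1 - (\<alpha> + b + 2) * t) * poly (binom_trunc \<alpha> N) t"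
    by (simp add: jacobi_op_def poly_jacobi_first pderiv_binom_trunc_int)
  then show "poly (jacobi_op \<alpha> b (binom_trunc_int \<alpha> N)) t = poly (smult (b + 1) ([:1, -1:] * binom_trunc \<alpha> N)
      - monom ((real N + \<alpha> + 1) * binom_coeff \<alpha> N) (Suc N)) t"
    unfolding pderiv_binom_trunc by (simp add: poly_monom algebra_simps)
qed

text \<open>The same substitution leaves (\<alpha> t + 1/2) q, split as (\<alpha> + 1/2) t q + (1 -
  t) q / 2 to isolate the unbounded part.\<close>

lemma jacobi_op_half_binom_trunc_int:
  "jacobi_op (-1/2) (-1/2) (binom_trunc_int \<alpha> N) =
    smult (\<alpha> + 1/2) ([:0, 1:] * binom_trunc \<alpha> N) + smult (1/2) ([:1, -1:] * binom_trunc \<alpha> N)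
    - monom ((real N + \<alpha> + 1) * binom_coeff \<alpha> N) (Suc N)"
proof (rule poly_ext)
  fix t
  have "poly (jacobi_op (-1/2) (-1/2) (binom_trunc_int \<alpha> N)) t =
      t * ((1 - t) * poly (pderiv (binom_trunc \<alpha> N)) t) + (1/2 - t) * poly (binom_trunc \<alpha> N) t"
    by (simp add: jacobi_op_def poly_jacobi_first pderiv_binom_trunc_int)
  then show "poly (jacobi_op (-1/2) (-1/2) (binom_trunc_int \<alpha> N)) t =
    poly (smult (\<alpha> + 1/2) ([:0, 1:] * binom_trunc \<alpha> N) + smult (1/2) ([:1, -1:] * binom_trunc \<alpha> N)
    - monom ((real N + \<alpha> + 1) * binom_coeff \<alpha> N) (Suc N)) t"
    unfolding pderiv_binom_trunc by (simp add: poly_monom algebra_simps)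
qed

text \<open>The left side of \<open>jacobi_op_binom_trunc_int\<close> has mean zero, so the mass of
  the top monomial follows without a Beta integral.\<close>

lemma jint_binom_trunc_last:
  "jint \<alpha> \<beta> (monom ((real N + \<alpha> + 1) * binom_coeff \<alpha> N) (Suc N)) =
    (\<beta> + 1) * jint \<alpha> \<beta> ([:1, -1:] * binom_trunc \<alpha> N)"
  using jint_jacobi_first[OF ab, of "pderiv (binom_trunc_int \<alpha> N)"]
  by (simp only: jacobi_op_def[symmetric] jacobi_op_binom_trunc_int jint_diff[OF ab] jint_smult[OF ab])

lemma one_minus_binom_trunc_nonneg:
  assumes "0 \<le> t" "t \<le> 1"
  shows "0 \<le> poly ([:1, -1:] * binom_trunc \<alpha> N) t"
proof -
  have "poly ([:1, -1:] * binom_trunc \<alpha> N) t = (1 - t) * poly (binom_trunc \<alpha> N) t" by (simp add: algebra_simps)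
  then show ?thesis using binom_trunc_nonneg[OF ab(1)] assms by simp
qed

lemma jnorm_binom_trunc_last:
  "jnorm \<alpha> \<beta> (monom ((real N + \<alpha> + 1) * binom_coeff \<alpha> N) (Suc N)) =
    (\<beta> + 1) * jint \<alpha> \<beta> ([:1, -1:] * binom_trunc \<alpha> N)"
proof -
  have "0 \<le> poly (monom ((real N + \<alpha> + 1) * binom_coeff \<alpha> N) (Suc N)) t" if "0 \<le> t" for t
    unfolding poly_monom using that ab binom_coeff_pos[OF ab(1), of N]
    by (intro mult_nonneg_nonneg zero_le_power) auto
  then show ?thesis by (subst jnorm_eq_jint) (auto simp only: jint_binom_trunc_last)
qed

lemma jnorm_jacobi_op_binom_trunc_int:
  "jnorm \<alpha> \<beta> (jacobi_op \<alpha> \<beta> (binom_trunc_int \<alpha> N)) \<le>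
    2 * (\<beta> + 1) * jint \<alpha> \<beta> ([:1, -1:] * binom_trunc \<alpha> N)"
proof -
  let ?Q = "[:1, -1:] * binom_trunc \<alpha> N" and ?r = "monom ((real N + \<alpha> + 1) * binom_coeff \<alpha> N) (Suc N)"
  have "jnorm \<alpha> \<beta> (jacobi_op \<alpha> \<beta> (binom_trunc_int \<alpha> N)) \<le> jnorm \<alpha> \<beta> (smult (\<beta> + 1) ?Q) + jnorm \<alpha> \<beta> ?r"
    unfolding jacobi_op_binom_trunc_int by (rule jnorm_diff_le[OF ab])
  also have "jnorm \<alpha> \<beta> (smult (\<beta> + 1) ?Q) = (\<beta> + 1) * jint \<alpha> \<beta> ?Q"
    using ab by (simp only: jnorm_smult jnorm_eq_jint[OF one_minus_binom_trunc_nonneg])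
  also have "jnorm \<alpha> \<beta> ?r = (\<beta> + 1) * jint \<alpha> \<beta> ?Q"
    by (rule jnorm_binom_trunc_last)
  finally show ?thesis by (simp only: mult_2 distrib_right)
qed

text \<open>Testing against \<open>t\<close> in the symmetry relation bounds the integral of the antiderivative without
  computing it.\<close>
lemma jint_binom_trunc_int_le:
  "(\<alpha> + 1) * jint \<alpha> \<beta> (binom_trunc_int \<alpha> N) \<le>
    (\<alpha> + \<beta> + 2 + 2 * (\<beta> + 1)) * jint \<alpha> \<beta> ([:1, -1:] * binom_trunc \<alpha> N)"
proof -
  let ?Q = "[:1, -1:] * binom_trunc \<alpha> N" and ?p = "binom_trunc_int \<alpha> N"
  \<comment> \<open>Written around t = 1, the constant - (\<alpha> + 1) extracts the integral of
    \<open>?p\<close>, and the rest carries a factor 1 - t.\<close>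
  have "jacobi_op \<alpha> \<beta> [:0, 1:] = smult (\<alpha> + \<beta> + 2) [:1, -1:] - [:\<alpha> + 1:]"
    by (simp add: jacobi_op_def jacobi_first_def pderiv_pCons)
  then have "?p * jacobi_op \<alpha> \<beta> [:0, 1:] = smult (\<alpha> + \<beta> + 2) ([:1, -1:] * ?p) - smult (\<alpha> + 1) ?p"
    by (intro poly_ext) (simp add: algebra_simps)
  then have "jint \<alpha> \<beta> (jacobi_op \<alpha> \<beta> ?p * [:0, 1:]) =
      jint \<alpha> \<beta> (smult (\<alpha> + \<beta> + 2) ([:1, -1:] * ?p) - smult (\<alpha> + 1) ?p)"
    by (simp only: jint_jacobi_op_sym[OF ab])
  then have eq: "(\<alpha> + 1) * jint \<alpha> \<beta> ?p =
      (\<alpha> + \<beta> + 2) * jint \<alpha> \<beta> ([:1, -1:] * ?p) + jint \<alpha> \<beta> (- (jacobi_op \<alpha> \<beta> ?p * [:0, 1:]))"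
    by (simp only: jint_diff[OF ab] jint_smult[OF ab] jint_minus[OF ab])
  have "jint \<alpha> \<beta> (- (jacobi_op \<alpha> \<beta> ?p * [:0, 1:])) \<le> jnorm \<alpha> \<beta> (jacobi_op \<alpha> \<beta> ?p)"
  proof -
    have "jint \<alpha> \<beta> (- (jacobi_op \<alpha> \<beta> ?p * [:0, 1:])) \<le> jnorm \<alpha> \<beta> (- (jacobi_op \<alpha> \<beta> ?p * [:0, 1:]))"
      by (rule jint_le_jnorm[OF ab])
    also have "\<dots> \<le> jnorm \<alpha> \<beta> (jacobi_op \<alpha> \<beta> ?p)"
      by (rule jnorm_mono[OF ab]) (simp add: abs_mult mult_left_le_one_le mult_right_le_one_le)
    finally show ?thesis .
  qed
  also have "\<dots> \<le> 2 * (\<beta> + 1) * jint \<alpha> \<beta> ?Q" by (rule jnorm_jacobi_op_binom_trunc_int)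
  finally have 1: "jint \<alpha> \<beta> (- (jacobi_op \<alpha> \<beta> ?p * [:0, 1:])) \<le> 2 * (\<beta> + 1) * jint \<alpha> \<beta> ?Q" .
  have "jint \<alpha> \<beta> ([:1, -1:] * ?p) \<le> jint \<alpha> \<beta> ?Q"
  proof (rule jint_mono[OF ab])
    fix t :: real assume t: "0 \<le> t" "t \<le> 1"
    have "(1 - t) * poly ?p t \<le> (1 - t) * poly (binom_trunc \<alpha> N) t"
      using t binom_trunc_int_le[OF ab(1)] by (intro mult_left_mono) auto
    then show "poly ([:1, -1:] * ?p) t \<le> poly ?Q t" by (simp add: algebra_simps)
  qed
  then have "(\<alpha> + \<beta> + 2) * jint \<alpha> \<beta> ([:1, -1:] * ?p) \<le> (\<alpha> + \<beta> + 2) * jint \<alpha> \<beta> ?Q"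
    using ab by (intro mult_left_mono) auto
  with 1 show ?thesis unfolding eq by (simp only: distrib_right)
qed

text \<open>Each moment is expressed by a lower truncation through \<open>jint_binom_trunc_last\<close>, which reduces the
  claim to the divergence of the harmonic series.\<close>
lemma jint_binom_trunc_unbounded:
  "\<exists>N. B < jint \<alpha> \<beta> ([:0, 1:] * binom_trunc \<alpha> N)"
proof (rule ccontr)
  assume "\<not> ?thesis"
  then have B: "jint \<alpha> \<beta> ([:0, 1:] * binom_trunc \<alpha> N) \<le> B" for N by (simp add: not_less)
  \<comment> \<open>This is the bound from the truncation at 0; the divisor \<alpha> + 2 anticipates
    j + \<alpha> + 1 \<le> (\<alpha> + 2)(j + 1).\<close>
  define m where "m = (\<beta> + 1) * jint \<alpha> \<beta> ([:1, -1:] * binom_trunc \<alpha> 0) / (\<alpha> + 2)"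
  have "0 < jint \<alpha> \<beta> ([:1, -1:] * binom_trunc \<alpha> 0)"
    by (rule jint_pos[OF ab one_minus_binom_trunc_nonneg])
      (auto simp: binom_trunc_def binom_coeff_def monom_0)
  then have m: "m > 0" using ab by (simp add: m_def)
  have low: "m * inverse (real (Suc j)) \<le> jint \<alpha> \<beta> (monom (binom_coeff \<alpha> j) (Suc j))" for j
  proof -
    have "jint \<alpha> \<beta> ([:1, -1:] * binom_trunc \<alpha> 0) \<le> jint \<alpha> \<beta> ([:1, -1:] * binom_trunc \<alpha> j)"
    proof (rule jint_mono[OF ab])
      fix t :: real assume t: "0 \<le> t" "t \<le> 1"
      have "poly (binom_trunc \<alpha> 0) t \<le> poly (binom_trunc \<alpha> j) t"
        unfolding binom_trunc_def poly_sum poly_monom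
        using t binom_coeff_pos[OF ab(1)] by (intro sum_mono2) (auto simp: less_imp_le)
      then have "(1 - t) * poly (binom_trunc \<alpha> 0) t \<le> (1 - t) * poly (binom_trunc \<alpha> j) t"
        using t by (intro mult_left_mono) auto
      then show "poly ([:1, -1:] * binom_trunc \<alpha> 0) t \<le> poly ([:1, -1:] * binom_trunc \<alpha> j) t"
        by (simp add: algebra_simps)
    qed
    then have "m * (\<alpha> + 2) \<le> (\<beta> + 1) * jint \<alpha> \<beta> ([:1, -1:] * binom_trunc \<alpha> j)"
      using ab by (simp add: m_def del: mult_pCons_left)
    also have "\<dots> = jint \<alpha> \<beta> (smult (real j + \<alpha> + 1) (monom (binom_coeff \<alpha> j) (Suc j)))"
      by (simp only: jint_binom_trunc_last[symmetric] smult_monom)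
    also have "\<dots> = (real j + \<alpha> + 1) * jint \<alpha> \<beta> (monom (binom_coeff \<alpha> j) (Suc j))"
      by (rule jint_smult[OF ab])
    finally have 1: "m * (\<alpha> + 2) \<le> (real j + \<alpha> + 1) * jint \<alpha> \<beta> (monom (binom_coeff \<alpha> j) (Suc j))" .
    have pos: "0 \<le> jint \<alpha> \<beta> (monom (binom_coeff \<alpha> j) (Suc j))"
      using binom_coeff_pos[OF ab(1), of j]
      by (subst jnorm_eq_jint[symmetric]) (auto simp: poly_monom jnorm_nonneg)
    \<comment> \<open>The two sides differ by (\<alpha> + 1) j + 1.\<close>
    have "real j + \<alpha> + 1 \<le> (\<alpha> + 2) * real (Suc j)"
      using mult_right_mono[of "-1" \<alpha> "real j"] ab by (simp add: algebra_simps)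
    from order_trans[OF 1 mult_right_mono[OF this pos]]
    have "m \<le> real (Suc j) * jint \<alpha> \<beta> (monom (binom_coeff \<alpha> j) (Suc j))"
      using ab by (simp add: mult.assoc mult.commute[of m] del: of_nat_Suc)
    then show ?thesis by (simp add: divide_simps mult.commute flip: divide_inverse del: of_nat_Suc)
  qed
  have "(\<Sum>j\<le>N. inverse (real (Suc j))) \<le> B / m" for N
  proof -
    have "m * (\<Sum>j\<le>N. inverse (real (Suc j))) \<le> (\<Sum>j\<le>N. jint \<alpha> \<beta> (monom (binom_coeff \<alpha> j) (Suc j)))"
      unfolding sum_distrib_left by (intro sum_mono low)
    also have "\<dots> = jint \<alpha> \<beta> (\<Sum>j\<le>N. monom (binom_coeff \<alpha> j) (Suc j))"
      by (rule jint_sum[OF ab, symmetric])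
    also have "(\<Sum>j\<le>N. monom (binom_coeff \<alpha> j) (Suc j)) = [:0, 1:] * binom_trunc \<alpha> N"
      by (rule poly_ext) (simp add: binom_trunc_def poly_sum poly_monom sum_distrib_left mult_ac)
    also have "jint \<alpha> \<beta> \<dots> \<le> B" by (rule B)
    finally show ?thesis using m by (simp add: field_simps)
  qed
  then have "summable (\<lambda>j. inverse (real (Suc j)))"
    by (intro bounded_imp_summable) auto
  then show False
    using not_summable_harmonic[where 'a = real] summable_Suc_iff[of "\<lambda>n. inverse (real n)"] by simp
qed

end

text \<open>Under a bound C, all terms but (\<alpha> + 1/2) t q are at most fixed multiples of the
  integral of (1 - t) q, hence bounded in N; then the integral of t q would be bounded too. An
  arbitrary \<open>c\<close> covers \<tau>^2 for the parameters in either order.\<close>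

lemma jacobi_second_derivative_unbounded:
  assumes "\<alpha> > -1" "\<beta> > -1" "\<alpha> \<noteq> -1/2"
  shows "\<exists>p. C * jnorm \<alpha> \<beta> (smult c p - jacobi_op \<alpha> \<beta> p) < jnorm \<alpha> \<beta> (jacobi_op (-1/2) (-1/2) p)"
proof (rule ccontr)
  note ab = assms(1,2)
  assume "\<not> ?thesis"
  then have C: "jnorm \<alpha> \<beta> (jacobi_op (-1/2) (-1/2) p) \<le> C * jnorm \<alpha> \<beta> (smult c p - jacobi_op \<alpha> \<beta> p)" for p
    by (simp add: not_less)
  obtain M where M: "\<And>N. jint \<alpha> \<beta> ([:1, -1:] * binom_trunc \<alpha> N) \<le> M"
    using jint_binom_trunc_bounded[OF ab] by blast
  \<comment> \<open>In units of the integral of (1 - t) q, \<open>L\<close> bounds the norm of the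
    test polynomial, \<open>D\<close> that of the input, and \<open>K\<close> that of (\<alpha> +
    1/2) t q, with 1/2 and \<beta> + 1 coming from the two remaining terms.\<close>
  define L where "L = (\<alpha> + \<beta> + 2 + 2 * (\<beta> + 1)) / (\<alpha> + 1)"
  have L: "0 \<le> L" using ab unfolding L_def by (intro divide_nonneg_pos) auto
  define D where "D = \<bar>c\<bar> * L + 2 * (\<beta> + 1)"
  have D: "0 \<le> D" unfolding D_def using ab
    by (intro add_nonneg_nonneg[OF mult_nonneg_nonneg[OF abs_ge_zero L]]) simp
  define K where "K = \<bar>C\<bar> * D + 1/2 + (\<beta> + 1)"
  have K: "0 \<le> K" unfolding K_def add.assoc using ab
    by (intro add_nonneg_nonneg[OF mult_nonneg_nonneg[OF abs_ge_zero D]]) simp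
  have "\<bar>\<alpha> + 1/2\<bar> * jint \<alpha> \<beta> ([:0, 1:] * binom_trunc \<alpha> N) \<le> K * M" for N
  proof -
    define Q r p S where "Q = [:1, -1:] * binom_trunc \<alpha> N"
      and "r = monom ((real N + \<alpha> + 1) * binom_coeff \<alpha> N) (Suc N)"
      and "p = binom_trunc_int \<alpha> N" and "S = [:0, 1:] * binom_trunc \<alpha> N"
    note defs = Q_def r_def p_def S_def
    have Q: "jnorm \<alpha> \<beta> Q = jint \<alpha> \<beta> Q"
      unfolding defs by (rule jnorm_eq_jint[OF one_minus_binom_trunc_nonneg[OF ab]])
    have r: "jnorm \<alpha> \<beta> r = (\<beta> + 1) * jint \<alpha> \<beta> Q"
      unfolding defs by (rule jnorm_binom_trunc_last[OF ab])
    have "jnorm \<alpha> \<beta> p = jint \<alpha> \<beta> p"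
      unfolding defs by (rule jnorm_eq_jint[OF binom_trunc_int_nonneg[OF ab(1)]])
    then have p: "jnorm \<alpha> \<beta> p \<le> L * jint \<alpha> \<beta> Q"
      using jint_binom_trunc_int_le[OF ab, of N, folded defs] ab
      by (simp add: L_def pos_le_divide_eq mult.commute)
    have "jnorm \<alpha> \<beta> (smult c p - jacobi_op \<alpha> \<beta> p) \<le> \<bar>c\<bar> * jnorm \<alpha> \<beta> p + jnorm \<alpha> \<beta> (jacobi_op \<alpha> \<beta> p)"
      using jnorm_diff_le[OF ab, of "smult c p" "jacobi_op \<alpha> \<beta> p"] by (simp only: jnorm_smult)
    also have "\<dots> \<le> \<bar>c\<bar> * (L * jint \<alpha> \<beta> Q) + 2 * (\<beta> + 1) * jint \<alpha> \<beta> Q"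
      using p jnorm_jacobi_op_binom_trunc_int[OF ab, of N, folded defs] by (intro add_mono mult_left_mono) auto
    finally have f: "jnorm \<alpha> \<beta> (smult c p - jacobi_op \<alpha> \<beta> p) \<le> D * jint \<alpha> \<beta> Q"
      by (simp only: D_def distrib_right mult.assoc)
    note C[of p]
    also have "C * jnorm \<alpha> \<beta> (smult c p - jacobi_op \<alpha> \<beta> p) \<le> \<bar>C\<bar> * jnorm \<alpha> \<beta> (smult c p - jacobi_op \<alpha> \<beta> p)"
      by (intro mult_right_mono jnorm_nonneg) auto
    also have "\<dots> \<le> \<bar>C\<bar> * (D * jint \<alpha> \<beta> Q)"
      by (intro mult_left_mono f) auto
    finally have g: "jnorm \<alpha> \<beta> (jacobi_op (-1/2) (-1/2) p) \<le> \<bar>C\<bar> * (D * jint \<alpha> \<beta> Q)" .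
    have "smult (\<alpha> + 1/2) S = (jacobi_op (-1/2) (-1/2) p - smult (1/2) Q) + r"
      using jacobi_op_half_binom_trunc_int[OF ab, of N, folded defs] by simp
    then have "\<bar>\<alpha> + 1/2\<bar> * jnorm \<alpha> \<beta> S \<le>
        jnorm \<alpha> \<beta> (jacobi_op (-1/2) (-1/2) p) + 1/2 * jint \<alpha> \<beta> Q + (\<beta> + 1) * jint \<alpha> \<beta> Q"
      using jnorm_add_le[OF ab, of "jacobi_op (-1/2) (-1/2) p - smult (1/2) Q" r]
        jnorm_diff_le[OF ab, of "jacobi_op (-1/2) (-1/2) p" "smult (1/2) Q"]
        jnorm_smult[of \<alpha> \<beta> "\<alpha> + 1/2" S] jnorm_smult[of \<alpha> \<beta> "1/2" Q]
      unfolding Q r by simp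
    also have "\<dots> \<le> K * jint \<alpha> \<beta> Q"
      using g by (simp add: K_def distrib_right mult.assoc)
    also have "\<dots> \<le> K * M" unfolding defs by (intro mult_left_mono M K)
    finally show ?thesis
      unfolding S_def[symmetric]
      by (rule order_trans[OF mult_left_mono[OF jint_le_jnorm[OF ab] abs_ge_zero]])
  qed
  moreover obtain N where "K * M / \<bar>\<alpha> + 1/2\<bar> < jint \<alpha> \<beta> ([:0, 1:] * binom_trunc \<alpha> N)"
    using jint_binom_trunc_unbounded[OF ab] by blast
  moreover have "0 < \<bar>\<alpha> + 1/2\<bar>" using assms(3) by auto
  ultimately show False by (simp only: pos_divide_less_eq mult.commute) (metis not_less)
qed

theorem proposition2p5:
  fixes \<alpha> \<beta> :: real
  assumes "\<alpha> > -1" and "\<beta> > -1"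
    and "(\<alpha>, \<beta>) \<noteq> (-1/2, -1/2)"
  shows "\<not> riesz_jacobi2_bounded_L1 \<alpha> \<beta>"
proof
  note ab = assms(1,2)
  assume "riesz_jacobi2_bounded_L1 \<alpha> \<beta>"
  then obtain C where C: "\<And>p. jnorm \<alpha> \<beta> (jacobi_op (-1/2) (-1/2) p) \<le>
      C * jnorm \<alpha> \<beta> (smult ((jacobi_tau \<alpha> \<beta>)\<^sup>2) p - jacobi_op \<alpha> \<beta> p)"
    using riesz_jacobi2_poly[OF ab] unfolding riesz_jacobi2_bounded_L1_def jnorm_def by blast
  show False
  proof (cases "\<alpha> = -1/2")
    case False
    then show False using jacobi_second_derivative_unbounded[OF ab] C by (meson not_less)
  next
    case True
    then have "\<beta> \<noteq> -1/2" using assms(3) by simp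
    then obtain p where p: "C * jnorm \<beta> \<alpha> (smult ((jacobi_tau \<alpha> \<beta>)\<^sup>2) p - jacobi_op \<beta> \<alpha> p) <
        jnorm \<beta> \<alpha> (jacobi_op (-1/2) (-1/2) p)"
      using jacobi_second_derivative_unbounded[OF ab(2,1)] by blast
    \<comment> \<open>Reflection swaps the parameters of the Jacobi operator and commutes with the
      second derivative, whose parameters are equal.\<close>
    have "smult ((jacobi_tau \<alpha> \<beta>)\<^sup>2) (pcompose p [:1, -1:]) - jacobi_op \<alpha> \<beta> (pcompose p [:1, -1:]) =
        pcompose (smult ((jacobi_tau \<alpha> \<beta>)\<^sup>2) p - jacobi_op \<beta> \<alpha> p) [:1, -1:]"
      by (simp add: jacobi_op_pcompose pcompose_diff pcompose_smult)
    with C[of "pcompose p [:1, -1:]"] p show False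
      by (simp only: jacobi_op_pcompose jnorm_pcompose)
  qed
qed

end
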